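(* Let $J$ be a non-infinitesimal interval of ${}^\bullet\mathbb{R}$ and let $f:J\to{}^\bullet\mathbb{R}$ be a smooth function. Let $\{I_1,\dots,I_n\}$ and $\{J_1,\dots,J_m\}$ be two finite families of pairwise disjoint intervals in $\mathscr{I}$, all contained in $J$, such that $\bigcup_{i=1}^n I_i=\bigcup_{j=1}^m J_j=:U$. Then $$\sum_{i=1}^n\int_{I_i}f=\sum_{j=1}^m\int_{J_j}f,$$ and this common value is denoted $\int_U f$.
   Context: Fermat reals: let $\mathbb{R}_o[t]$ be the set of maps $x:\mathbb{R}_{\ge0}\to\mathbb{R}$, $t\mapsto x_t$, of the form $x_t=r+\sum_{i=1}^k\alpha_i t^{a_i}+o(t)$ as $t\to0^+$, with $k\in\mathbb{N}$, $r,\alpha_i\in\mathbb{R}$, $a_i\in\mathbb{R}_{\ge0}$. Write $x\sim y$ iff $x_t=y_t+o(t)$ as $t\to0^+$. The ring of Fermat reals is ${}^\bullet\mathbb{R}:=\mathbb{R}_o[t]/\sim$ with pointwise operations; $\mathbb{R}\subseteq{}^\bullet\mathbb{R}$ via constants. The standard part of $x=[x_t]$ is ${}^\circ x:=x_0$. ${}^\bullet\mathbb{R}$ is totally ordered by: $x\le y$ iff for representatives there is $z\in\mathbb{R}_o[t]$ with $z\sim0$ and $x_t\le y_t+z_t$ for all small $t\ge0$. $\overline{{}^\bullet\mathbb{R}}:={}^\bullet\mathbb{R}\cup\{\pm\infty\}$, ${}^\circ(\pm\infty):=\pm\infty$. An interval is a set $[a,b],(a,b),[a,b),(a,b]$ of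 points of ${}^\bullet\mathbb{R}$ with $a\le b$ in $\overline{{}^\bullet\mathbb{R}}$ (it determines its endpoints $a=\inf$, $b=\sup$); non-infinitesimal if ${}^\circ a<{}^\circ b$; $\mathscr{I}$ denotes the set of all intervals. The Fermat topology on ${}^\bullet\mathbb{R}^n$ has open sets ${}^\bullet V:=\{x:{}^\circ x\in V\}$, $V\subseteq\mathbb{R}^n$ open. For $\alpha\in C^\infty(W,\mathbb{R}^m)$, $W\subseteq\mathbb{R}^d$ open, ${}^\bullet\alpha([x_t]):=[\alpha(x_t)]$. A map $f:S\to{}^\bullet\mathbb{R}^m$, $S\subseteq{}^\bullet\mathbb{R}^n$, is smooth if for every $x\in S$ there exist open $V\subseteq\mathbb{R}^n$ with $x\in{}^\bullet V$, open $P\subseteq\mathbb{R}^{\mathsf p}$, $p\in{}^\bullet P$, $\alpha\in C^\infty(P\times V,\mathbb{R}^m)$ with $f(y)={}^\bullet\alpha(p,y)$ for $y\in{}^\bullet V\cap S$. For $g$ smooth on a non-infinitesimal interval $J$ and $x\in J$, $g'(x):={}^\bullet(\partial_2\alpha)(p,x)$ for any local representation of $g$ around $x$ (independent of it). Integral: for a non-infinitesimal interval $J$, smooth $f:J\to{}^\bullet\mathbb{R}$ and $u\in J$, $\int_u^{(-)}f$ is the unique smooth $I:J\to{}^\bullet\mathbb{R}$ with $I(u)=0$ and $I'(x)=f(x)$ for all $x\in J$, and $\int_u^v f:=I(v)$ for $v\in J$. For an interval $I\in\mathscr{I}$ contained in $J$, $\int_I f:=\int_{\inf(I)}^{\sup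(I)}f$.
   Formalization: The intervals I_i and J_j are also required to have finite endpoints lying in J, since the integral from inf to sup is defined only for endpoints in J (for instance, it is undefined for I = J = (0,1)). *)

theory Defs
  imports "HOL-Analysis.Analysis"
begin

text \<open>Representatives are maps real to real; only their values at t >= 0 matter.
  "h = o(t) as t -> 0+" is read as: h 0 = 0 and h t / t -> 0 as t -> 0+.\<close>

definition little_o :: "(real \<Rightarrow> real) \<Rightarrow> bool" where
  "little_o h \<longleftrightarrow> h 0 = 0 \<and> ((\<lambda>t. h t / t) \<longlongrightarrow> 0) (at_right 0)"

definition tpow :: "real \<Rightarrow> real \<Rightarrow> real" where
  "tpow t a = (if a = 0 then 1 else t powr a)"

definition Ro :: "(real \<Rightarrow> real) set" where
  "Ro = {x. \<exists>(k::nat) (r::real) (\<alpha>::nat \<Rightarrow> real) (a::nat \<Rightarrow> real).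
            (\<forall>i<k. 0 \<le> a i) \<and>
            little_o (\<lambda>t. x t - (r + (\<Sum>i<k. \<alpha> i * tpow t (a i))))}"

definition fermrel :: "(real \<Rightarrow> real) \<Rightarrow> (real \<Rightarrow> real) \<Rightarrow> bool" where
  "fermrel x y \<longleftrightarrow> x \<in> Ro \<and> y \<in> Ro \<and> little_o (\<lambda>t. x t - y t)"

lemma little_o_zero: "little_o (\<lambda>t. 0)"
  unfolding little_o_def by simp

lemma little_o_minus: "little_o h \<Longrightarrow> little_o (\<lambda>t. - h t)"
  unfolding little_o_def by (auto dest: tendsto_minus)

lemma little_o_add: "little_o h \<Longrightarrow> little_o g \<Longrightarrow> little_o (\<lambda>t. h t + g t)"
  unfolding little_o_def by (auto simp: add_divide_distrib dest: tendsto_add)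

lemma zero_in_Ro: "(\<lambda>t. 0) \<in> Ro"
  unfolding Ro_def by (rule CollectI, rule exI[of _ 0], rule exI[of _ 0]) (auto simp: little_o_zero)

lemma part_equivp_fermrel: "part_equivp fermrel"
proof (rule part_equivpI)
  show "\<exists>x. fermrel x x"
    using zero_in_Ro by (auto simp: fermrel_def little_o_zero)
  show "symp fermrel"
  proof (rule sympI)
    fix x y assume "fermrel x y"
    then have "little_o (\<lambda>t. - (x t - y t))" unfolding fermrel_def by (intro little_o_minus) blast
    then have "little_o (\<lambda>t. y t - x t)" by simp
    with \<open>fermrel x y\<close> show "fermrel y x" by (simp add: fermrel_def)
  qed
  show "transp fermrel"
  proof (rule transpI)
    fix x y z assume "fermrel x y" "fermrel y z"
    then have "little_o (\<lambda>t. (x t - y t) + (y t - z t))"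
      unfolding fermrel_def by (intro little_o_add) blast+
    then have "little_o (\<lambda>t. x t - z t)" by simp
    with \<open>fermrel x y\<close> \<open>fermrel y z\<close> show "fermrel x z" by (simp add: fermrel_def)
  qed
qed

quotient_type fermat = "real \<Rightarrow> real" / partial: fermrel
  by (rule part_equivp_fermrel)

definition fzero :: fermat where "fzero = abs_fermat (\<lambda>t. 0)"
definition fadd :: "fermat \<Rightarrow> fermat \<Rightarrow> fermat" where
  "fadd x y = abs_fermat (\<lambda>t. rep_fermat x t + rep_fermat y t)"

fun fsum :: "(nat \<Rightarrow> fermat) \<Rightarrow> nat \<Rightarrow> fermat" where
  "fsum x 0 = fzero"
| "fsum x (Suc n) = fadd (fsum x n) (x (Suc n))"

definition st :: "fermat \<Rightarrow> real" where "st x = rep_fermat x 0"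

instantiation fermat :: ord
begin
definition less_eq_fermat :: "fermat \<Rightarrow> fermat \<Rightarrow> bool" where
  "(x::fermat) \<le> y \<longleftrightarrow> (\<exists>z. fermrel z (\<lambda>t. 0) \<and>
      (\<exists>\<delta>>0. \<forall>t. 0 \<le> t \<and> t < \<delta> \<longrightarrow> rep_fermat x t \<le> rep_fermat y t + z t))"
definition less_fermat :: "fermat \<Rightarrow> fermat \<Rightarrow> bool" where
  "(x::fermat) < y \<longleftrightarrow> x \<le> y \<and> x \<noteq> y"
instance ..
end

datatype fext = MInf | Fin fermat | PInf

fun fext_le :: "fext \<Rightarrow> fext \<Rightarrow> bool" where
  "fext_le MInf _ = True"
| "fext_le (Fin x) MInf = False"
| "fext_le (Fin x) (Fin y) = (x \<le> y)"
| "fext_le (Fin x) PInf = True"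
| "fext_le PInf b = (b = PInf)"

definition fext_lt :: "fext \<Rightarrow> fext \<Rightarrow> bool" where
  "fext_lt a b \<longleftrightarrow> fext_le a b \<and> a \<noteq> b"

fun fext_st :: "fext \<Rightarrow> ereal" where
  "fext_st MInf = -\<infinity>"
| "fext_st (Fin x) = ereal (st x)"
| "fext_st PInf = \<infinity>"

definition fint_with :: "fermat set \<Rightarrow> fext \<Rightarrow> fext \<Rightarrow> bool" where
  "fint_with S a b \<longleftrightarrow> fext_le a b \<and>
     (S = {x. fext_le a (Fin x) \<and> fext_le (Fin x) b} \<or>
      S = {x. fext_lt a (Fin x) \<and> fext_lt (Fin x) b} \<or>
      S = {x. fext_le a (Fin x) \<and> fext_lt (Fin x) b} \<or>
      S = {x. fext_lt a (Fin x) \<and> fext_le (Fin x) b})"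

definition is_fint :: "fermat set \<Rightarrow> bool" where
  "is_fint S \<longleftrightarrow> (\<exists>a b. fint_with S a b)"

definition noninf_fint :: "fermat set \<Rightarrow> bool" where
  "noninf_fint S \<longleftrightarrow> (\<exists>a b. fint_with S a b \<and> fext_st a < fext_st b)"

text \<open>R^d is represented as the vectors z :: nat => real vanishing from index d on
  (product topology, which on this subspace is the Euclidean one).\<close>
definition Rd :: "nat \<Rightarrow> (nat \<Rightarrow> real) set" where
  "Rd d = {z. \<forall>i\<ge>d. z i = 0}"

definition open_Rd :: "nat \<Rightarrow> (nat \<Rightarrow> real) set \<Rightarrow> bool" where
  "open_Rd d P \<longleftrightarrow> P \<subseteq> Rd d \<and> openin (top_of_set (Rd d)) P"

definition smooth_Rd :: "nat \<Rightarrow> (nat \<Rightarrow> real) set \<Rightarrow> ((nat \<Rightarrow> real) \<Rightarrow> real) \<Rightarrow> bool" where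
  "smooth_Rd d U g \<longleftrightarrow> (\<exists>D :: nat list \<Rightarrow> (nat \<Rightarrow> real) \<Rightarrow> real.
      (\<forall>z\<in>U. D [] z = g z) \<and>
      (\<forall>ks. set ks \<subseteq> {..<d} \<longrightarrow>
         continuous_on U (D ks) \<and>
         (\<forall>i<d. \<forall>z\<in>U. ((\<lambda>s. D ks (z(i := s))) has_real_derivative D (i # ks) z) (at (z i)))))"

text \<open>P x V as a subset of R^(pd+1): parameters in coordinates < pd, variable in coordinate pd.\<close>
definition prodPV :: "nat \<Rightarrow> (nat \<Rightarrow> real) set \<Rightarrow> real set \<Rightarrow> (nat \<Rightarrow> real) set" where
  "prodPV pd P V = {z. z \<in> Rd (Suc pd) \<and> z(pd := 0) \<in> P \<and> z pd \<in> V}"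

definition flift :: "nat \<Rightarrow> ((nat \<Rightarrow> real) \<Rightarrow> real) \<Rightarrow> (nat \<Rightarrow> fermat) \<Rightarrow> fermat \<Rightarrow> fermat" where
  "flift pd \<alpha> p y = abs_fermat (\<lambda>t. \<alpha> ((\<lambda>i. if i < pd then rep_fermat (p i) t else 0)
                                          (pd := rep_fermat y t)))"

definition stp :: "nat \<Rightarrow> (nat \<Rightarrow> fermat) \<Rightarrow> (nat \<Rightarrow> real)" where
  "stp pd p = (\<lambda>i. if i < pd then st (p i) else 0)"

definition local_rep :: "fermat set \<Rightarrow> (fermat \<Rightarrow> fermat) \<Rightarrow> fermat \<Rightarrow> nat \<Rightarrow>
    (nat \<Rightarrow> real) set \<Rightarrow> real set \<Rightarrow> (nat \<Rightarrow> fermat) \<Rightarrow> ((nat \<Rightarrow> real) \<Rightarrow> real) \<Rightarrow> bool" where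
  "local_rep S f x pd P V p \<alpha> \<longleftrightarrow>
     open V \<and> st x \<in> V \<and> open_Rd pd P \<and> stp pd p \<in> P \<and>
     smooth_Rd (Suc pd) (prodPV pd P V) \<alpha> \<and>
     (\<forall>y\<in>S. st y \<in> V \<longrightarrow> f y = flift pd \<alpha> p y)"

definition fsmooth_on :: "fermat set \<Rightarrow> (fermat \<Rightarrow> fermat) \<Rightarrow> bool" where
  "fsmooth_on S f \<longleftrightarrow> (\<forall>x\<in>S. \<exists>pd P V p \<alpha>. local_rep S f x pd P V p \<alpha>)"

definition pderiv_at :: "nat \<Rightarrow> ((nat \<Rightarrow> real) \<Rightarrow> real) \<Rightarrow> (nat \<Rightarrow> real) \<Rightarrow> real" where
  "pderiv_at i \<alpha> z = deriv (\<lambda>s. \<alpha> (z(i := s))) (z i)"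

text \<open>Derivative g'(x) via any local representation (independent of the choice).\<close>
definition fderiv_on :: "fermat set \<Rightarrow> (fermat \<Rightarrow> fermat) \<Rightarrow> fermat \<Rightarrow> fermat" where
  "fderiv_on S g x = (SOME d. \<exists>pd P V p \<alpha>. local_rep S g x pd P V p \<alpha> \<and>
                                   d = flift pd (pderiv_at pd \<alpha>) p x)"

definition fintegral :: "fermat set \<Rightarrow> (fermat \<Rightarrow> fermat) \<Rightarrow> fermat \<Rightarrow> fermat \<Rightarrow> fermat" where
  "fintegral J f u v = (THE c. \<exists>I. fsmooth_on J I \<and> I u = fzero \<and>
                                   (\<forall>x\<in>J. fderiv_on J I x = f x) \<and> I v = c)"

end

theory Submission
  imports Defs
begin

text \<open>Locally a smooth function is a combination \<open>\<Sum> w\<^sub>m \<phi>\<^sub>m\<close> of ordinary smooth functions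
  \<open>\<phi>\<^sub>m\<close> with constant Fermat real coefficients \<open>w\<^sub>m\<close>: the parameters differ from their
  standard parts by nilpotents, so Taylor expansion in them is finite. If such a combination
  vanishes at all standard points of an open set, elimination rewrites it so that every function
  involved vanishes there; hence all its derivatives vanish on the closure of the set, even at
  nonstandard points. This makes derivatives independent of the representation and primitives
  locally unique up to constants. Primitives of combinations are glued along the connected set of
  standard parts, so \<open>\<integral>\<^sub>u\<^sup>v f = F v - F u\<close> for a global primitive \<open>F\<close>, and the theorem becomes a
  statement about telescoping sums in a dense linear order.\<close>

section \<open>Little-oh polynomials\<close>

text \<open>The ring has zero divisors, so a relation \<Sum> w \<phi> = 0 says little about the
  single \<phi>. At a standard point, however, the functions take real values, and one may divide by
  a nonzero one; this is why elimination at standard points, and not a comparison of terms, stands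
  between a representation and its derivative. A second obstacle is the ends of J: a point of J may
  lie over an end of the interval of standard parts where J contains no standard point at all, so
  information must be carried there from an open core by continuity of ordinary derivatives. Third,
  points with equal standard parts have the same Fermat neighbourhoods. Hence connectedness,
  bisection and gluing take place on the real line, while the intervals of the two families may be
  infinitesimal and all lie over one real number. A primitive F still tells such points apart, and
  the final step uses only their order.\<close>

lemma little_o_tendsto:
  assumes h: "little_o h"
  shows "(h \<longlongrightarrow> 0) (at_right 0)"
proof -
  have "((\<lambda>t. h t / t * t) \<longlongrightarrow> 0 * 0) (at_right 0)"
    using h unfolding little_o_def by (intro tendsto_mult tendsto_ident_at) auto
  moreover have "\<forall>\<^sub>F t in at_right 0. h t / t * t = h t"
    using eventually_at_right_less[of 0] by eventually_elim auto
  ultimately show ?thesis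
    by (auto dest: Lim_transform_eventually)
qed

lemma little_o_mult:
  assumes h: "little_o h" and g: "(g \<longlongrightarrow> l) (at_right 0)"
  shows "little_o (\<lambda>t. h t * g t)"
  unfolding little_o_def
  using tendsto_mult[OF conjunct2[OF h[unfolded little_o_def]] g] h
  by (simp add: little_o_def)

lemma little_o_diff: "little_o h \<Longrightarrow> little_o g \<Longrightarrow> little_o (\<lambda>t. h t - g t)"
  using little_o_add[OF _ little_o_minus, of h g] by simp

lemma little_o_sum: "(\<And>i. i \<in> A \<Longrightarrow> little_o (h i)) \<Longrightarrow> little_o (\<lambda>t. \<Sum>i\<in>A. h i t)"
  by (induction A rule: infinite_finite_induct) (auto simp: little_o_zero intro: little_o_add)

lemma little_o_bound:
  assumes h: "little_o h" and g0: "g 0 = 0"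
    and le: "\<forall>\<^sub>F t in at_right 0. \<bar>g t\<bar> \<le> C * \<bar>h t\<bar>"
  shows "little_o g"
proof -
  have "((\<lambda>t. C * \<bar>h t / t\<bar>) \<longlongrightarrow> C * \<bar>0\<bar>) (at_right 0)"
    using h unfolding little_o_def by (intro tendsto_intros) auto
  moreover have "\<forall>\<^sub>F t in at_right 0. \<bar>g t / t\<bar> \<le> C * \<bar>h t / t\<bar>"
    using le eventually_at_right_less[of 0]
    by eventually_elim (auto simp: divide_simps abs_mult)
  ultimately have "((\<lambda>t. g t / t) \<longlongrightarrow> 0) (at_right 0)"
    using Lim_null_comparison[of "\<lambda>t. g t / t" "\<lambda>t. C * \<bar>h t / t\<bar>"] by simp
  then show ?thesis using g0 by (simp add: little_o_def)
qed

text \<open>Generation by single monomials makes closure under sums and products a matter of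
  induction; \<open>power_sums_indexed\<close> returns to the indexed sums in the definition of
  \<open>Ro\<close>.\<close>

inductive_set power_sums :: "(real \<Rightarrow> real) set" where
  zero: "(\<lambda>t. 0) \<in> power_sums"
| add_monom: "g \<in> power_sums \<Longrightarrow> 0 \<le> a \<Longrightarrow> (\<lambda>t. g t + c * tpow t a) \<in> power_sums"

lemma tpow_add: "0 \<le> a \<Longrightarrow> 0 \<le> b \<Longrightarrow> tpow t (a + b) = tpow t a * tpow t b"
  by (auto simp: tpow_def powr_add)

text \<open>Since \<open>0 powr 0 = 0\<close>, it is the separate case a = 0 of \<open>tpow\<close>
  that makes the constant monomial right-continuous at 0.\<close>

lemma tpow_tendsto: "0 \<le> a \<Longrightarrow> ((\<lambda>t. tpow t a) \<longlongrightarrow> tpow 0 a) (at_right 0)"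
proof (cases "a = 0")
  case False
  assume "0 \<le> a"
  have "((\<lambda>t. t powr a) \<longlongrightarrow> 0 powr a) (at_right 0)"
    using False \<open>0 \<le> a\<close>
    by (intro tendsto_powr2 tendsto_intros)
       (auto simp: eventually_at_filter intro: always_eventually)
  then show ?thesis using False by (simp add: tpow_def)
qed (simp add: tpow_def)

lemma power_sums_add:
  assumes "f \<in> power_sums" "g \<in> power_sums"
  shows "(\<lambda>t. f t + g t) \<in> power_sums"
  using assms(2,1)
  by (induction g rule: power_sums.induct)
     (auto simp: add.assoc[symmetric] intro: power_sums.add_monom)

lemma power_sums_mult_monom:
  "g \<in> power_sums \<Longrightarrow> 0 \<le> a \<Longrightarrow> (\<lambda>t. g t * (c * tpow t a)) \<in> power_sums"
proof (induction g rule: power_sums.induct)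
  case (add_monom g b d)
  have "(\<lambda>t. g t * (c * tpow t a) + (d * c) * tpow t (b + a)) \<in> power_sums"
    using add_monom by (intro power_sums.add_monom) auto
  then show ?case
    using add_monom by (simp add: tpow_add algebra_simps)
qed (auto intro: power_sums.zero)

lemma power_sums_mult:
  assumes "f \<in> power_sums" "g \<in> power_sums"
  shows "(\<lambda>t. f t * g t) \<in> power_sums"
  using assms(2)
proof (induction g rule: power_sums.induct)
  case (add_monom g a c)
  then show ?case
    using power_sums_add[OF _ power_sums_mult_monom[OF assms(1)]] by (simp add: distrib_left)
qed (auto intro: power_sums.zero)

lemma power_sums_tendsto: "g \<in> power_sums \<Longrightarrow> (g \<longlongrightarrow> g 0) (at_right 0)"
  by (induction g rule: power_sums.induct) (auto intro!: tendsto_intros tpow_tendsto)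

lemma power_sums_const: "(\<lambda>t. r) \<in> power_sums"
  using power_sums.add_monom[OF power_sums.zero, of 0 r] by (simp add: tpow_def)

lemma power_sums_sum:
  "\<forall>i<k::nat. 0 \<le> a i \<Longrightarrow> (\<lambda>t. r + (\<Sum>i<k. \<alpha> i * tpow t (a i))) \<in> power_sums"
proof (induction k)
  case (Suc k)
  then have "(\<lambda>t. (r + (\<Sum>i<k. \<alpha> i * tpow t (a i))) + \<alpha> k * tpow t (a k)) \<in> power_sums"
    by (intro power_sums.add_monom) auto
  then show ?case by (simp add: add.assoc)
qed (auto intro: power_sums_const)

lemma power_sums_indexed:
  "g \<in> power_sums \<Longrightarrow>
    \<exists>(k::nat) \<alpha> a. (\<forall>i<k. 0 \<le> a i) \<and> g = (\<lambda>t. \<Sum>i<k. \<alpha> i * tpow t (a i))"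
proof (induction g rule: power_sums.induct)
  case zero
  show ?case by (intro exI[of _ 0]) auto
next
  case (add_monom g b c)
  then obtain k \<alpha> a where "\<forall>i<k::nat. 0 \<le> a i" "g = (\<lambda>t. \<Sum>i<k. \<alpha> i * tpow t (a i))"
    by blast
  with add_monom(2) show ?case
    by (intro exI[of _ "Suc k"] exI[of _ "\<alpha>(k := c)"] exI[of _ "a(k := b)"]) (auto simp: less_Suc_eq)
qed

lemma Ro_iff: "x \<in> Ro \<longleftrightarrow> (\<exists>g\<in>power_sums. little_o (\<lambda>t. x t - g t))"
proof
  assume "x \<in> Ro"
  then obtain k r \<alpha> a where "\<forall>i<k::nat. 0 \<le> a i"
    "little_o (\<lambda>t. x t - (r + (\<Sum>i<k. \<alpha> i * tpow t (a i))))"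
    unfolding Ro_def by auto
  then show "\<exists>g\<in>power_sums. little_o (\<lambda>t. x t - g t)"
    by (intro bexI[OF _ power_sums_sum[of k a r \<alpha>]]) auto
next
  assume "\<exists>g\<in>power_sums. little_o (\<lambda>t. x t - g t)"
  then obtain g where "g \<in> power_sums" "little_o (\<lambda>t. x t - g t)" by blast
  then obtain k \<alpha> a where "\<forall>i<k::nat. 0 \<le> a i"
    "little_o (\<lambda>t. x t - (\<Sum>i<k. \<alpha> i * tpow t (a i)))"
    using power_sums_indexed[of g] by auto
  then show "x \<in> Ro"
    unfolding Ro_def
    by (intro CollectI exI[of _ k] exI[of _ 0] exI[of _ \<alpha>] exI[of _ a]) auto
qed

lemma RoE:
  assumes "x \<in> Ro"
  obtains g h where "g \<in> power_sums" "little_o h" "x = (\<lambda>t. g t + h t)"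
  using assms unfolding Ro_iff by (auto intro!: that[of _ "\<lambda>t. x t - _ t"])

lemma RoI: "g \<in> power_sums \<Longrightarrow> little_o h \<Longrightarrow> (\<lambda>t. g t + h t) \<in> Ro"
  unfolding Ro_iff by (rule bexI[of _ g]) auto

lemma Ro_const: "(\<lambda>t. r) \<in> Ro"
  using RoI[OF power_sums_const little_o_zero] by simp

lemma little_o_Ro: "little_o h \<Longrightarrow> h \<in> Ro"
  using RoI[OF power_sums.zero] by simp

lemma Ro_tendsto: "x \<in> Ro \<Longrightarrow> (x \<longlongrightarrow> x 0) (at_right 0)"
proof (erule RoE)
  fix g h assume g: "g \<in> power_sums" and h: "little_o h" and x: "x = (\<lambda>t. g t + h t)"
  have "((\<lambda>t. g t + h t) \<longlongrightarrow> g 0 + 0) (at_right 0)"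
    by (intro tendsto_add power_sums_tendsto g little_o_tendsto h)
  then show ?thesis using x h by (simp add: little_o_def)
qed

lemma Ro_add: "x \<in> Ro \<Longrightarrow> y \<in> Ro \<Longrightarrow> (\<lambda>t. x t + y t) \<in> Ro"
proof (elim RoE)
  fix g h g' h' assume *: "g \<in> power_sums" "little_o h" "x = (\<lambda>t. g t + h t)"
    "g' \<in> power_sums" "little_o h'" "y = (\<lambda>t. g' t + h' t)"
  then show ?thesis
    using RoI[OF power_sums_add[OF *(1,4)] little_o_add[OF *(2,5)]] by (simp add: algebra_simps)
qed

lemma Ro_mult: "x \<in> Ro \<Longrightarrow> y \<in> Ro \<Longrightarrow> (\<lambda>t. x t * y t) \<in> Ro"
proof (elim RoE)
  fix g h g' h' assume *: "g \<in> power_sums" "little_o h" "x = (\<lambda>t. g t + h t)"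
    "g' \<in> power_sums" "little_o h'" "y = (\<lambda>t. g' t + h' t)"
  \<comment> \<open>This is the product minus g g'; each summand is o(t) times a function with a
    limit at 0.\<close>
  have "little_o (\<lambda>t. h t * g' t + h' t * (g t + h t))"
    by (intro little_o_add little_o_mult[OF *(2) power_sums_tendsto[OF *(4)]]
        little_o_mult[OF *(5) tendsto_add[OF power_sums_tendsto[OF *(1)] little_o_tendsto[OF *(2)]]])
  from RoI[OF power_sums_mult[OF *(1,4)] this] show ?thesis
    using * by (simp add: algebra_simps)
qed

lemma Ro_uminus: "x \<in> Ro \<Longrightarrow> (\<lambda>t. - x t) \<in> Ro"
  using Ro_mult[OF Ro_const[of "-1"], of x] by simp

lemma Ro_diff: "x \<in> Ro \<Longrightarrow> y \<in> Ro \<Longrightarrow> (\<lambda>t. x t - y t) \<in> Ro"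
  using Ro_add[OF _ Ro_uminus, of x y] by simp

lemma Ro_power: "x \<in> Ro \<Longrightarrow> (\<lambda>t. x t ^ n) \<in> Ro"
  by (induction n) (auto intro: Ro_const Ro_mult)

lemma Ro_sum: "(\<And>i. i \<in> A \<Longrightarrow> x i \<in> Ro) \<Longrightarrow> (\<lambda>t. \<Sum>i\<in>A. x i t) \<in> Ro"
  by (induction A rule: infinite_finite_induct) (auto intro: Ro_const Ro_add)

lemma Ro_cong_little_o: "x \<in> Ro \<Longrightarrow> little_o (\<lambda>t. y t - x t) \<Longrightarrow> y \<in> Ro"
  using Ro_add[OF _ little_o_Ro, of x "\<lambda>t. y t - x t"] by simp

text \<open>Equal exponents are collected, so that the term with the least exponent cannot be
  cancelled by another one. The search for a leading term depends on this.\<close>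

lemma power_sums_finite_support:
  "g \<in> power_sums \<Longrightarrow> \<exists>S c. finite S \<and> S \<subseteq> {0..} \<and> g = (\<lambda>t. \<Sum>a\<in>S. c a * tpow t a)"
proof (induction g rule: power_sums.induct)
  case zero
  show ?case by (intro exI[of _ "{}"]) auto
next
  case (add_monom g a d)
  then obtain S c where S: "finite S" "S \<subseteq> {0..}" "g = (\<lambda>t. \<Sum>a\<in>S. c a * tpow t a)" by blast
  define c' where "c' b = (if b \<in> S then c b else 0) + (if b = a then d else 0)" for b
  have "(\<Sum>b\<in>insert a S. c' b * tpow t b) = g t + d * tpow t a" for t
  proof -
    have "(\<Sum>b\<in>insert a S. c' b * tpow t b)
        = (\<Sum>b\<in>insert a S. if b \<in> S then c b * tpow t b else 0)
        + (\<Sum>b\<in>insert a S. if b = a then d * tpow t b else 0)"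
      unfolding sum.distrib[symmetric] c'_def by (intro sum.cong) (auto simp: distrib_right)
    also have "(\<Sum>b\<in>insert a S. if b \<in> S then c b * tpow t b else 0) = g t"
      unfolding S(3) using S(1) by (intro sum.mono_neutral_cong_right) auto
    also have "(\<Sum>b\<in>insert a S. if b = a then d * tpow t b else 0) = d * tpow t a"
      using S(1) by (simp add: sum.delta)
    finally show ?thesis .
  qed
  then show ?case
    using S add_monom(2) by (intro exI[of _ "insert a S"] exI[of _ c']) auto
qed

lemma tpow_little_o:
  assumes a: "1 < a"
  shows "little_o (\<lambda>t. c * tpow t a)"
proof -
  have "((\<lambda>t. c * tpow t (a - 1)) \<longlongrightarrow> c * tpow 0 (a - 1)) (at_right 0)"
    using a by (intro tendsto_intros tpow_tendsto) auto
  moreover have "\<forall>\<^sub>F t in at_right 0. c * tpow t (a - 1) = c * tpow t a / t"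
    using eventually_at_right_less[of 0]
    by eventually_elim (use a in \<open>auto simp: tpow_def powr_diff\<close>)
  ultimately have "((\<lambda>t. c * tpow t a / t) \<longlongrightarrow> 0) (at_right 0)"
    using a by (auto simp: tpow_def dest: Lim_transform_eventually)
  then show ?thesis
    using a by (simp add: little_o_def tpow_def)
qed

text \<open>The exponent of the leading term never exceeds 1, since higher powers are absorbed by
  \<open>o(t)\<close>; the exponent 1 itself survives.\<close>

lemma Ro_leading_term:
  assumes "x \<in> Ro"
  shows "little_o x \<or> (\<exists>a c. 0 \<le> a \<and> a \<le> 1 \<and> c \<noteq> 0 \<and> ((\<lambda>t. x t / tpow t a) \<longlongrightarrow> c) (at_right 0))"
proof -
  obtain g h where gh: "g \<in> power_sums" "little_o h" "x = (\<lambda>t. g t + h t)"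
    using RoE[OF assms] .
  obtain S c where S: "finite S" "S \<subseteq> {0..}" "g = (\<lambda>t. \<Sum>a\<in>S. c a * tpow t a)"
    using power_sums_finite_support[OF gh(1)] by blast
  define S' where "S' = {a\<in>S. a \<le> 1 \<and> c a \<noteq> 0}"
  define k where "k = (\<lambda>t. (\<Sum>a\<in>S - S'. c a * tpow t a) + h t)"
  have "little_o (\<lambda>t. c a * tpow t a)" if "a \<in> S - S'" for a
    using that tpow_little_o[of a "c a"] by (cases "c a = 0") (auto simp: S'_def little_o_zero)
  then have k: "little_o k"
    unfolding k_def by (intro little_o_add little_o_sum gh(2)) auto
  have S': "finite S'" "S' \<subseteq> S" using S(1) by (auto simp: S'_def)
  have x: "x t = (\<Sum>a\<in>S'. c a * tpow t a) + k t" for t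
    unfolding gh(3) S(3) k_def using sum.subset_diff[OF S'(2) S(1), of "\<lambda>a. c a * tpow t a"]
    by simp
  show ?thesis
  proof (cases "S' = {}")
    case True
    then have "x = k" using x by auto
    then show ?thesis using k by simp
  next
    case False
    define a where "a = Min S'"
    have a: "a \<in> S'" unfolding a_def using S'(1) False by simp
    then have a01: "0 \<le> a" "a \<le> 1" "c a \<noteq> 0" using S(2) S'(2) by (auto simp: S'_def)
    have pos: "\<forall>\<^sub>F t::real in at_right 0. 0 < t" by (rule eventually_at_right_less)
    have summand: "((\<lambda>t. c b * tpow t b / tpow t a) \<longlongrightarrow> (if b = a then c a else 0)) (at_right 0)"
      if b: "b \<in> S'" for b
    proof -
      have "a \<le> b" using b S'(1) by (simp add: a_def)
      then have "((\<lambda>t. c b * tpow t (b - a)) \<longlongrightarrow> c b * tpow 0 (b - a)) (at_right 0)"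
        by (intro tendsto_intros tpow_tendsto) auto
      moreover have "\<forall>\<^sub>F t in at_right 0. c b * tpow t (b - a) = c b * tpow t b / tpow t a"
        using pos by eventually_elim (use \<open>a \<le> b\<close> a01(1) in \<open>auto simp: tpow_def powr_diff\<close>)
      ultimately show ?thesis
        by (auto simp: tpow_def dest: Lim_transform_eventually)
    qed
    \<comment> \<open>Because a \<le> 1, the quotient of k by t^a is k(t)/t times a power of t with
      nonnegative exponent, so the error term stays negligible.\<close>
    have "((\<lambda>t. k t / t * tpow t (1 - a)) \<longlongrightarrow> 0 * tpow 0 (1 - a)) (at_right 0)"
      using k a01 unfolding little_o_def by (intro tendsto_mult tpow_tendsto) auto
    moreover have "\<forall>\<^sub>F t in at_right 0. k t / t * tpow t (1 - a) = k t / tpow t a"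
      using pos by eventually_elim (auto simp: tpow_def powr_diff)
    ultimately have "((\<lambda>t. k t / tpow t a) \<longlongrightarrow> 0) (at_right 0)"
      by (auto dest: Lim_transform_eventually)
    then have "((\<lambda>t. (\<Sum>b\<in>S'. c b * tpow t b / tpow t a) + k t / tpow t a)
        \<longlongrightarrow> (\<Sum>b\<in>S'. if b = a then c a else 0) + 0) (at_right 0)"
      by (intro tendsto_add tendsto_sum summand)
    then have "((\<lambda>t. x t / tpow t a) \<longlongrightarrow> c a) (at_right 0)"
      using a S'(1) by (simp add: x add_divide_distrib sum_divide_distrib sum.delta)
    then show ?thesis using a01 by blast
  qed
qed

text \<open>The leading exponent a is positive because x tends to 0. The N-th power then behaves
  like t^(N a), which is o(t) as soon as N a > 1.\<close>

lemma Ro_nilpotent: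
  assumes x: "x \<in> Ro" and x0: "x 0 = 0"
  shows "\<exists>N>0. little_o (\<lambda>t. x t ^ N)"
  using Ro_leading_term[OF x]
proof (elim disjE exE conjE)
  assume "little_o x"
  then show ?thesis by (intro exI[of _ 1]) auto
next
  fix a c assume a: "0 \<le> a" "a \<le> 1" and c: "c \<noteq> (0::real)"
    and lim: "((\<lambda>t. x t / tpow t a) \<longlongrightarrow> c) (at_right 0)"
  have "a \<noteq> 0"
  proof
    assume "a = 0"
    with lim have "(x \<longlongrightarrow> c) (at_right 0)" by (simp add: tpow_def)
    then show False
      using Ro_tendsto[OF x] x0 c tendsto_unique[of "at_right (0::real)" x] by auto
  qed
  with a have "0 < a" by simp
  obtain N :: nat where N: "real N * a > 1"
    using ex_less_of_nat_mult[OF \<open>0 < a\<close>] by blast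
  have "((\<lambda>t. (x t / tpow t a) ^ N * tpow t (real N * a - 1)) \<longlongrightarrow> c ^ N * tpow 0 (real N * a - 1))
      (at_right 0)"
    using N by (intro tendsto_intros lim tpow_tendsto) auto
  moreover have "\<forall>\<^sub>F t in at_right 0. (x t / tpow t a) ^ N * tpow t (real N * a - 1) = x t ^ N / t"
    using eventually_at_right_less[of 0]
  proof eventually_elim
    case (elim t)
    then have "tpow t a ^ N = t powr (real N * a)"
      using \<open>0 < a\<close> by (simp add: tpow_def powr_powr powr_realpow[symmetric] mult.commute)
    with elim N show ?case by (simp add: tpow_def powr_diff power_divide)
  qed
  ultimately have "((\<lambda>t. x t ^ N / t) \<longlongrightarrow> 0) (at_right 0)"
    using N by (auto simp: tpow_def dest: Lim_transform_eventually)
  moreover have "N > 0" using N by (cases N) auto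
  ultimately show ?thesis using x0 by (intro exI[of _ N]) (auto simp: little_o_def)
qed

section \<open>The ordered ring of Fermat reals\<close>

lemma fermrel_refl_iff: "fermrel x x \<longleftrightarrow> x \<in> Ro"
  by (auto simp: fermrel_def little_o_zero)

lemma rep_fermat_Ro: "rep_fermat x \<in> Ro"
  using Quotient3_rep_reflp[OF Quotient3_fermat] fermrel_refl_iff by blast

lemma abs_rep_fermat: "abs_fermat (rep_fermat x) = x"
  by (rule Quotient3_abs_rep[OF Quotient3_fermat])

lemma abs_fermat_eq_iff:
  "x \<in> Ro \<Longrightarrow> y \<in> Ro \<Longrightarrow> abs_fermat x = abs_fermat y \<longleftrightarrow> little_o (\<lambda>t. x t - y t)"
  using Quotient3_rel[OF Quotient3_fermat, of x y] by (auto simp: fermrel_def little_o_zero)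

lemma abs_fermat_eqI: "x \<in> Ro \<Longrightarrow> little_o (\<lambda>t. y t - x t) \<Longrightarrow> abs_fermat y = abs_fermat x"
  using abs_fermat_eq_iff[of y x] Ro_cong_little_o[of x y] by simp

lemma rep_abs_fermat: "x \<in> Ro \<Longrightarrow> little_o (\<lambda>t. rep_fermat (abs_fermat x) t - x t)"
  using abs_fermat_eq_iff[OF rep_fermat_Ro, of x "abs_fermat x"] abs_rep_fermat by auto

lemma fermat_cases:
  obtains r where "r \<in> Ro" "x = abs_fermat r"
  using abs_rep_fermat rep_fermat_Ro by metis

instantiation fermat :: comm_ring_1
begin

definition "0 = abs_fermat (\<lambda>t. 0)"
definition "1 = abs_fermat (\<lambda>t. 1)"
definition "x + y = abs_fermat (\<lambda>t. rep_fermat x t + rep_fermat y t)"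
definition "x - y = abs_fermat (\<lambda>t. rep_fermat x t - rep_fermat y t)"
definition "- x = abs_fermat (\<lambda>t. - rep_fermat x t)"
definition "x * y = abs_fermat (\<lambda>t. rep_fermat x t * rep_fermat y t)"

text \<open>The operations are defined on chosen representatives; this lemma and the next three
  allow them to be computed on arbitrary ones, which reduces the ring axioms to those of real
  functions.\<close>

lemma abs_fermat_plus:
  assumes "x \<in> Ro" "y \<in> Ro"
  shows "abs_fermat x + abs_fermat y = abs_fermat (\<lambda>t. x t + y t)"
  unfolding plus_fermat_def
  using little_o_add[OF rep_abs_fermat[OF assms(1)] rep_abs_fermat[OF assms(2)]]
  by (intro abs_fermat_eqI Ro_add assms) (simp add: algebra_simps)

lemma abs_fermat_minus:
  assumes "x \<in> Ro" "y \<in> Ro"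
  shows "abs_fermat x - abs_fermat y = abs_fermat (\<lambda>t. x t - y t)"
  unfolding minus_fermat_def
  using little_o_diff[OF rep_abs_fermat[OF assms(1)] rep_abs_fermat[OF assms(2)]]
  by (intro abs_fermat_eqI Ro_diff assms) (simp add: algebra_simps)

lemma abs_fermat_uminus:
  assumes "x \<in> Ro"
  shows "- abs_fermat x = abs_fermat (\<lambda>t. - x t)"
  unfolding uminus_fermat_def
  using little_o_minus[OF rep_abs_fermat[OF assms(1)]]
  by (intro abs_fermat_eqI Ro_uminus assms) simp

lemma abs_fermat_times:
  assumes "x \<in> Ro" "y \<in> Ro"
  shows "abs_fermat x * abs_fermat y = abs_fermat (\<lambda>t. x t * y t)"
proof -
  let ?x = "rep_fermat (abs_fermat x)" and ?y = "rep_fermat (abs_fermat y)"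
  have "little_o (\<lambda>t. (?x t - x t) * ?y t + (?y t - y t) * x t)"
    by (intro little_o_add little_o_mult[OF _ Ro_tendsto] rep_abs_fermat assms rep_fermat_Ro)
  then have "little_o (\<lambda>t. ?x t * ?y t - x t * y t)"
    by (simp add: algebra_simps)
  then show ?thesis
    unfolding times_fermat_def by (intro abs_fermat_eqI Ro_mult assms)
qed

instance
proof
  fix x y z :: fermat
  obtain a where a: "a \<in> Ro" "x = abs_fermat a" by (rule fermat_cases)
  obtain b where b: "b \<in> Ro" "y = abs_fermat b" by (rule fermat_cases)
  obtain c where c: "c \<in> Ro" "z = abs_fermat c" by (rule fermat_cases)
  note simps = zero_fermat_def one_fermat_def abs_fermat_plus abs_fermat_minus abs_fermat_uminus
    abs_fermat_times Ro_add Ro_mult Ro_diff Ro_uminus Ro_const a b c algebra_simps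
  show "x * y * z = x * (y * z)" "x * y = y * x" "1 * x = x" "x + y + z = x + (y + z)"
    "x + y = y + x" "0 + x = x" "- x + x = 0" "x - y = x + - y" "(x + y) * z = x * z + y * z"
    by (simp_all add: simps)
  have "\<not> little_o (\<lambda>t. 0 - 1)" by (simp add: little_o_def)
  then show "(0::fermat) \<noteq> 1"
    unfolding zero_fermat_def one_fermat_def using abs_fermat_eq_iff[OF Ro_const Ro_const] by blast
qed

end

lemma abs_fermat_power: "x \<in> Ro \<Longrightarrow> abs_fermat x ^ n = abs_fermat (\<lambda>t. x t ^ n)"
  by (induction n) (auto simp: one_fermat_def abs_fermat_times Ro_power)

lemma abs_fermat_sum:
  "(\<And>i. i \<in> A \<Longrightarrow> x i \<in> Ro) \<Longrightarrow> (\<Sum>i\<in>A. abs_fermat (x i)) = abs_fermat (\<lambda>t. \<Sum>i\<in>A. x i t)"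
  by (induction A rule: infinite_finite_induct)
     (auto simp: zero_fermat_def abs_fermat_plus Ro_sum)

lemma fzero_eq: "fzero = 0"
  by (simp add: fzero_def zero_fermat_def)

lemma fadd_eq: "fadd x y = x + y"
  by (simp add: fadd_def plus_fermat_def)

lemma fsum_eq: "fsum x n = (\<Sum>i\<in>{1..n}. x i)"
  by (induction n) (simp_all add: fzero_eq fadd_eq)

section \<open>Standard reals, standard parts and nilpotent remainders\<close>

definition fconst :: "real \<Rightarrow> fermat" where
  "fconst r = abs_fermat (\<lambda>t. r)"

lemma fconst_simps:
  "fconst 0 = 0" "fconst 1 = 1" "fconst (r + s) = fconst r + fconst s"
  "fconst (r - s) = fconst r - fconst s" "fconst (r * s) = fconst r * fconst s"
  "fconst (- r) = - fconst r"
  by (simp_all add: fconst_def zero_fermat_def one_fermat_def abs_fermat_plus abs_fermat_minus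
      abs_fermat_times abs_fermat_uminus Ro_const)

lemma st_abs_fermat: "x \<in> Ro \<Longrightarrow> st (abs_fermat x) = x 0"
  using rep_abs_fermat[of x] by (simp add: st_def little_o_def)

lemma st_fconst [simp]: "st (fconst r) = r"
  by (simp add: fconst_def st_abs_fermat Ro_const)

lemma fermat_nilpotent: "\<exists>N>0. (x - fconst (st x)) ^ N = 0"
proof -
  have x: "x - fconst (st x) = abs_fermat (\<lambda>t. rep_fermat x t - st x)"
    using abs_fermat_minus[OF rep_fermat_Ro Ro_const] by (simp add: fconst_def abs_rep_fermat)
  have Ro: "(\<lambda>t. rep_fermat x t - st x) \<in> Ro"
    by (intro Ro_diff rep_fermat_Ro Ro_const)
  then obtain N where "N > 0" "little_o (\<lambda>t. (rep_fermat x t - st x) ^ N)"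
    using Ro_nilpotent[OF Ro] by (auto simp: st_def)
  then have "abs_fermat (\<lambda>t. (rep_fermat x t - st x) ^ N) = 0"
    unfolding zero_fermat_def by (intro abs_fermat_eqI Ro_const) simp
  then show ?thesis
    using \<open>N > 0\<close> by (auto simp: x abs_fermat_power Ro)
qed

section \<open>The order\<close>

definition ev_nonneg :: "(real \<Rightarrow> real) \<Rightarrow> bool" where
  "ev_nonneg d \<longleftrightarrow> (\<exists>z. little_o z \<and> (\<forall>\<^sub>F t in at_right 0. 0 \<le> d t + z t))"

text \<open>The error z of order o(t) absorbs the choice of representatives, so the only content of
  the order is the eventual sign of a difference for t > 0.\<close>

lemma less_eq_fermat_iff_rep:
  "x \<le> y \<longleftrightarrow> ev_nonneg (\<lambda>t. rep_fermat y t - rep_fermat x t)"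
proof
  assume "x \<le> y"
  then obtain z \<delta> where z: "fermrel z (\<lambda>t. 0)" "\<delta> > 0"
    "\<And>t. 0 \<le> t \<Longrightarrow> t < \<delta> \<Longrightarrow> rep_fermat x t \<le> rep_fermat y t + z t"
    unfolding less_eq_fermat_def by blast
  have "\<forall>\<^sub>F t in at_right 0. 0 \<le> (rep_fermat y t - rep_fermat x t) + z t"
    unfolding eventually_at_right_field
  proof (intro exI[of _ \<delta>] conjI allI impI)
    fix t assume "0 < t" "t < \<delta>"
    then show "0 \<le> (rep_fermat y t - rep_fermat x t) + z t" using z(3)[of t] by simp
  qed (rule z(2))
  then show "ev_nonneg (\<lambda>t. rep_fermat y t - rep_fermat x t)"
    using z(1) by (auto simp: ev_nonneg_def fermrel_def)
next
  assume "ev_nonneg (\<lambda>t. rep_fermat y t - rep_fermat x t)"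
  then obtain z where z: "little_o z"
    and ev: "\<forall>\<^sub>F t in at_right 0. 0 \<le> (rep_fermat y t - rep_fermat x t) + z t"
    by (auto simp: ev_nonneg_def)
  have "\<forall>\<^sub>F t in at_right 0. rep_fermat x t \<le> rep_fermat y t + z t"
    using ev by eventually_elim simp
  then obtain \<delta> where \<delta>: "\<delta> > 0" "\<And>t. 0 < t \<Longrightarrow> t < \<delta> \<Longrightarrow> rep_fermat x t \<le> rep_fermat y t + z t"
    unfolding eventually_at_right_field by blast
  \<comment> \<open>The order also demands the inequality at t = 0; there it is the limit of the
    inequalities for t > 0.\<close>
  have "((\<lambda>t. (rep_fermat y t - rep_fermat x t) + z t)
      \<longlongrightarrow> (rep_fermat y 0 - rep_fermat x 0) + 0) (at_right 0)"
    by (intro tendsto_intros Ro_tendsto rep_fermat_Ro little_o_tendsto z)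
  from tendsto_lowerbound[OF this ev] have "rep_fermat x 0 \<le> rep_fermat y 0 + z 0"
    using z by (simp add: little_o_def)
  then have "\<forall>t. 0 \<le> t \<and> t < \<delta> \<longrightarrow> rep_fermat x t \<le> rep_fermat y t + z t"
    using \<delta>(2) by (metis order_le_less)
  then show "x \<le> y"
    unfolding less_eq_fermat_def using z \<delta>(1) little_o_Ro[OF z]
    by (intro exI[of _ z]) (auto simp: fermrel_def Ro_const)
qed

lemma ev_nonneg_add: "ev_nonneg d \<Longrightarrow> ev_nonneg e \<Longrightarrow> ev_nonneg (\<lambda>t. d t + e t)"
  unfolding ev_nonneg_def
proof (elim exE conjE)
  fix z w assume z: "little_o z" "\<forall>\<^sub>F t in at_right 0. 0 \<le> d t + z t"
    and w: "little_o w" "\<forall>\<^sub>F t in at_right 0. 0 \<le> e t + w t"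
  have "\<forall>\<^sub>F t in at_right 0. 0 \<le> d t + e t + (z t + w t)"
    using z(2) w(2) by eventually_elim auto
  then show "\<exists>z. little_o z \<and> (\<forall>\<^sub>F t in at_right 0. 0 \<le> d t + e t + z t)"
    using little_o_add[OF z(1) w(1)] by (intro exI[of _ "\<lambda>t. z t + w t"]) auto
qed

lemma ev_nonneg_little_o: "little_o d \<Longrightarrow> ev_nonneg d"
  unfolding ev_nonneg_def by (intro exI[of _ "\<lambda>t. - d t"]) (auto intro: little_o_minus)

lemma ev_nonneg_cong: "little_o (\<lambda>t. d t - e t) \<Longrightarrow> ev_nonneg d \<longleftrightarrow> ev_nonneg e"
  using ev_nonneg_add[of d "\<lambda>t. e t - d t"] ev_nonneg_add[of e "\<lambda>t. d t - e t"]
    ev_nonneg_little_o little_o_minus[of "\<lambda>t. d t - e t"] by auto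

lemma ev_nonneg_cmult:
  assumes c: "0 \<le> c" and d: "ev_nonneg d"
  shows "ev_nonneg (\<lambda>t. c * d t)"
proof -
  obtain z where z: "little_o z" "\<forall>\<^sub>F t in at_right 0. 0 \<le> d t + z t"
    using d by (auto simp: ev_nonneg_def)
  have "\<forall>\<^sub>F t in at_right 0. 0 \<le> c * d t + z t * c"
    using z(2)
  proof eventually_elim
    case (elim t)
    from mult_nonneg_nonneg[OF c elim] show ?case by (simp add: algebra_simps)
  qed
  then show ?thesis
    using little_o_mult[OF z(1) tendsto_const[of c]]
    unfolding ev_nonneg_def by (intro exI[of _ "\<lambda>t. z t * c"] conjI)
qed

lemma ev_nonneg_antisym:
  assumes "ev_nonneg d" "ev_nonneg (\<lambda>t. - d t)" "d \<in> Ro"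
  shows "little_o d"
proof -
  from assms obtain z w where z: "little_o z" "\<forall>\<^sub>F t in at_right 0. 0 \<le> d t + z t"
    and w: "little_o w" "\<forall>\<^sub>F t in at_right 0. 0 \<le> - d t + w t"
    by (auto simp: ev_nonneg_def)
  have lim: "((\<lambda>t. d t / t) \<longlongrightarrow> 0) (at_right 0)"
  proof (rule tendsto_sandwich)
    show "\<forall>\<^sub>F t in at_right 0. - z t / t \<le> d t / t"
      using z(2) eventually_at_right_less[of 0]
      by eventually_elim (rule divide_right_mono, auto)
    show "\<forall>\<^sub>F t in at_right 0. d t / t \<le> w t / t"
      using w(2) eventually_at_right_less[of 0]
      by eventually_elim (rule divide_right_mono, auto)
    show "((\<lambda>t. - z t / t) \<longlongrightarrow> 0) (at_right 0)" "((\<lambda>t. w t / t) \<longlongrightarrow> 0) (at_right 0)"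
      using little_o_minus[OF z(1)] w(1) by (auto simp: little_o_def)
  qed
  \<comment> \<open>\<open>little_o\<close> also asks for the value 0 at t = 0. It equals the limit
    of d, as d is in \<open>Ro\<close>, and this limit is 0 by the estimate just obtained.\<close>
  have "((\<lambda>t. d t / t * t) \<longlongrightarrow> 0 * 0) (at_right 0)"
    by (intro tendsto_mult lim tendsto_ident_at)
  moreover have "\<forall>\<^sub>F t in at_right 0. d t / t * t = d t"
    using eventually_at_right_less[of 0] by eventually_elim auto
  ultimately have "(d \<longlongrightarrow> 0) (at_right 0)"
    by (auto dest: Lim_transform_eventually)
  then have "d 0 = 0"
    using Ro_tendsto[OF assms(3)] tendsto_unique[of "at_right (0::real)" d] by auto
  then show ?thesis using lim by (simp add: little_o_def)
qed

text \<open>Unless d is o(t), the sign of its leading coefficient is its eventual sign.\<close>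

lemma ev_nonneg_total: "d \<in> Ro \<Longrightarrow> ev_nonneg d \<or> ev_nonneg (\<lambda>t. - d t)"
proof (drule Ro_leading_term, elim disjE exE conjE)
  assume "little_o d"
  then show ?thesis using ev_nonneg_little_o by blast
next
  have *: "ev_nonneg e" if "((\<lambda>t. e t / tpow t a) \<longlongrightarrow> c) (at_right 0)" "c > 0" for e a c
  proof -
    have "\<forall>\<^sub>F t in at_right 0. 0 < e t / tpow t a"
      using that order_tendstoD(1) by blast
    then have "\<forall>\<^sub>F t in at_right 0. 0 \<le> e t + 0"
      using eventually_at_right_less[of 0]
      by eventually_elim (auto simp: tpow_def zero_less_divide_iff split: if_splits)
    then show ?thesis
      using little_o_zero by (auto simp: ev_nonneg_def intro!: exI[of _ "\<lambda>_. 0"])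
  qed
  fix a c assume "c \<noteq> 0" and lim: "((\<lambda>t. d t / tpow t a) \<longlongrightarrow> c) (at_right 0)"
  then consider "c > 0" | "- c > 0" by linarith
  then show ?thesis
    using *[OF lim] *[of "\<lambda>t. - d t" a "- c"] tendsto_minus[OF lim] by cases auto
qed

lemma less_eq_abs_fermat_iff:
  assumes "x \<in> Ro" "y \<in> Ro"
  shows "abs_fermat x \<le> abs_fermat y \<longleftrightarrow> ev_nonneg (\<lambda>t. y t - x t)"
  unfolding less_eq_fermat_iff_rep
  using little_o_diff[OF rep_abs_fermat[OF assms(2)] rep_abs_fermat[OF assms(1)]]
  by (intro ev_nonneg_cong) (simp add: algebra_simps)

instance fermat :: linordered_ab_group_add
proof
  fix x y z :: fermat
  obtain a where a: "a \<in> Ro" "x = abs_fermat a" by (rule fermat_cases)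
  obtain b where b: "b \<in> Ro" "y = abs_fermat b" by (rule fermat_cases)
  obtain c where c: "c \<in> Ro" "z = abs_fermat c" by (rule fermat_cases)
  note iff = less_eq_abs_fermat_iff
  show "x \<le> x"
    using a ev_nonneg_little_o[OF little_o_zero] by (simp add: iff)
  show "x \<le> z" if "x \<le> y" "y \<le> z"
    using that a b c ev_nonneg_add[of "\<lambda>t. b t - a t" "\<lambda>t. c t - b t"] by (simp add: iff)
  show antisym: "x = y" if "x \<le> y" "y \<le> x"
    using that a b ev_nonneg_antisym[of "\<lambda>t. a t - b t"]
    by (simp add: iff abs_fermat_eq_iff Ro_diff)
  show "x \<le> y \<or> y \<le> x"
    using a b ev_nonneg_total[of "\<lambda>t. b t - a t"] by (simp add: iff Ro_diff)
  show "z + x \<le> z + y" if "x \<le> y"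
    using that a b c by (simp add: iff abs_fermat_plus Ro_add)
  show "x < y \<longleftrightarrow> x \<le> y \<and> \<not> y \<le> x"
    using antisym \<open>x \<le> x\<close> by (auto simp: less_fermat_def)
qed

lemma fconst_mult_nonneg:
  assumes "0 \<le> r" "0 \<le> x"
  shows "0 \<le> fconst r * x"
proof -
  obtain a where a: "a \<in> Ro" "x = abs_fermat a" by (rule fermat_cases)
  then show ?thesis
    using assms ev_nonneg_cmult[OF assms(1), of a]
    by (simp add: zero_fermat_def fconst_def abs_fermat_times less_eq_abs_fermat_iff Ro_const Ro_mult)
qed

text \<open>Nonzero standard reals are units, although the ring has nilpotents.\<close>

lemma fconst_mult_cancel: "r \<noteq> 0 \<Longrightarrow> fconst r * x = 0 \<longleftrightarrow> x = 0"
proof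
  assume r: "r \<noteq> 0" "fconst r * x = 0"
  have "x = fconst (inverse r * r) * x" using r(1) by (simp add: fconst_simps(2))
  also have "\<dots> = fconst (inverse r) * (fconst r * x)"
    by (simp only: fconst_simps(5) mult.assoc)
  finally show "x = 0" using r(2) by simp
qed simp

text \<open>The midpoint works: halving cannot annihilate a nonzero difference, even a nilpotent
  one. Density later supplies a sample point in every gap between endpoints.\<close>

instance fermat :: dense_linorder
proof
  fix x y :: fermat assume "x < y"
  define h where "h = fconst (1/2) * (y - x)"
  have "0 \<le> h" "h \<noteq> 0"
    using \<open>x < y\<close> fconst_mult_nonneg[of "1/2" "y - x"] fconst_mult_cancel[of "1/2" "y - x"]
    by (auto simp: h_def)
  then have "0 < h" by (simp add: order_less_le)
  moreover have "h + h = fconst (1/2 + 1/2) * (y - x)"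
    unfolding h_def by (simp only: fconst_simps distrib_right)
  then have "y = x + h + h" by (simp add: fconst_simps(2) algebra_simps)
  ultimately show "\<exists>z. x < z \<and> z < y"
    by (metis add_less_cancel_left add.right_neutral)
qed

lemma st_mono: "x \<le> y \<Longrightarrow> st x \<le> st y"
  unfolding less_eq_fermat_iff_rep ev_nonneg_def
proof (elim exE conjE)
  fix z assume "little_o z"
    and ev: "\<forall>\<^sub>F t in at_right 0. 0 \<le> rep_fermat y t - rep_fermat x t + z t"
  then have "((\<lambda>t. (rep_fermat y t - rep_fermat x t) + z t)
      \<longlongrightarrow> (rep_fermat y 0 - rep_fermat x 0) + 0) (at_right 0)"
    by (intro tendsto_intros Ro_tendsto rep_fermat_Ro little_o_tendsto)
  from tendsto_lowerbound[OF this ev] show ?thesis by (simp add: st_def)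
qed

lemma less_if_st_less: "st x < st y \<Longrightarrow> x < y"
  using st_mono[of y x] by (cases "x < y") (auto simp: not_less)

section \<open>Sums over finite families of disjoint intervals\<close>

text \<open>A telescoping sum: \<open>Min {x\<in>E. e < x}\<close> is the successor of e in E, and
  removing the first summand moves the left end from a to its successor.\<close>

lemma sum_successive_differences:
  fixes F :: "'a::linorder \<Rightarrow> 'b::ab_group_add"
  assumes E: "finite E" and "a \<in> E" "b \<in> E" "a \<le> b"
  shows "(\<Sum>e\<in>{e\<in>E. a \<le> e \<and> e < b}. F (Min {x\<in>E. e < x}) - F e) = F b - F a"
  using assms(2,4)
proof (induction "card {e\<in>E. a \<le> e \<and> e < b}" arbitrary: a rule: less_induct)
  case less
  show ?case
  proof (cases "a = b")
    case True
    then have none: "{e\<in>E. a \<le> e \<and> e < b} = {}" by auto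
    show ?thesis unfolding none using True by simp
  next
    case False
    define n where "n = Min {x\<in>E. a < x}"
    have fin: "finite {x\<in>E. a < x}" and ne: "b \<in> {x\<in>E. a < x}"
      using E False less.prems assms(3) by auto
    have n: "n \<in> E" "a < n" using Min_in[OF fin] ne by (auto simp: n_def)
    have n_le: "n \<le> x" if "x \<in> E" "a < x" for x
      using Min_le[OF fin] that by (auto simp: n_def)
    have "n \<le> b" using n_le ne by auto
    have split: "{e\<in>E. a \<le> e \<and> e < b} = insert a {e\<in>E. n \<le> e \<and> e < b}"
      using n n_le less.prems False by (auto simp: order_le_less dest: less_trans)
    have notin: "a \<notin> {e\<in>E. n \<le> e \<and> e < b}" using n(2) by (simp add: not_le)
    then have "{e\<in>E. n \<le> e \<and> e < b} \<subset> {e\<in>E. a \<le> e \<and> e < b}"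
      unfolding split by (simp only: psubset_eq subset_insertI) (metis insertI1)
    then have "card {e\<in>E. n \<le> e \<and> e < b} < card {e\<in>E. a \<le> e \<and> e < b}"
      using E by (intro psubset_card_mono) auto
    from less.hyps[OF this n(1) \<open>n \<le> b\<close>] show ?thesis
      unfolding split using E notin by (subst sum.insert) (simp_all add: n_def[symmetric])
  qed
qed

text \<open>Covers exactly the four kinds of interval from a to b; for a = b these are the empty set
  and the singleton. Integrals see the endpoints only, so no finer distinction is wanted.\<close>

definition between :: "'a::order set \<Rightarrow> 'a \<Rightarrow> 'a \<Rightarrow> bool" where
  "between S a b \<longleftrightarrow> a \<le> b \<and> {a<..<b} \<subseteq> S \<and> S \<subseteq> {a..b}"

text \<open>Both families are compared with the partition of their union into the gaps between
  successive elements of the set \<open>E\<close> of all endpoints: an interval contains exactly those gaps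
  of which it contains the sample point \<open>p e\<close>.\<close>

lemma sum_over_disjoint_intervals:
  fixes F :: "'a::dense_linorder \<Rightarrow> 'b::ab_group_add" and A :: "'i \<Rightarrow> 'a set"
  assumes E: "finite E"
    and p: "\<And>e. e \<in> E \<Longrightarrow> {x\<in>E. e < x} \<noteq> {} \<Longrightarrow> e < p e \<and> p e < Min {x\<in>E. e < x}"
    and N: "finite N"
    and A: "\<And>i. i \<in> N \<Longrightarrow> between (A i) (a i) (b i) \<and> a i \<in> E \<and> b i \<in> E"
    and disj: "\<And>i j. i \<in> N \<Longrightarrow> j \<in> N \<Longrightarrow> i \<noteq> j \<Longrightarrow> A i \<inter> A j = {}"
  shows "(\<Sum>i\<in>N. F (b i) - F (a i)) =
    (\<Sum>e\<in>{e\<in>E. {x\<in>E. e < x} \<noteq> {} \<and> p e \<in> (\<Union>i\<in>N. A i)}. F (Min {x\<in>E. e < x}) - F e)"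
proof -
  define G where "G i = {e\<in>E. {x\<in>E. e < x} \<noteq> {} \<and> p e \<in> A i}" for i
  have G: "{e\<in>E. a i \<le> e \<and> e < b i} = G i" if i: "i \<in> N" for i
  proof (intro set_eqI iffI)
    fix e assume e: "e \<in> {e\<in>E. a i \<le> e \<and> e < b i}"
    then have "b i \<in> {x\<in>E. e < x}" using A[OF i] by auto
    \<comment> \<open>The right end \<open>b i\<close> is itself an element of E beyond e, so the
      gap after e ends no later than \<open>b i\<close>.\<close>
    then have "Min {x\<in>E. e < x} \<le> b i" "{x\<in>E. e < x} \<noteq> {}" using E by (auto intro!: Min_le)
    with p[of e] e have "a i < p e" "p e < b i" by auto
    then show "e \<in> G i"
      using A[OF i] e \<open>{x\<in>E. e < x} \<noteq> {}\<close> by (auto simp: G_def between_def)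
  next
    fix e assume e: "e \<in> G i"
    then have *: "e < p e" "p e < Min {x\<in>E. e < x}" "a i \<le> p e" "p e \<le> b i"
      using p[of e] A[OF i] by (auto simp: G_def between_def)
    \<comment> \<open>No endpoint lies strictly inside a gap: if e < \<open>a i\<close>, the gap
      after e would end no later than \<open>a i\<close>, and its sample point could not be at least
      \<open>a i\<close>.\<close>
    have "Min {x\<in>E. e < x} \<le> a i" if "e < a i"
      using that A[OF i] E by (intro Min_le) auto
    with * have "a i \<le> e" by (meson leD leI order_trans)
    with * e show "e \<in> {e\<in>E. a i \<le> e \<and> e < b i}" by (auto simp: G_def)
  qed
  have "(\<Sum>i\<in>N. F (b i) - F (a i)) = (\<Sum>i\<in>N. \<Sum>e\<in>G i. F (Min {x\<in>E. e < x}) - F e)"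
    using A by (intro sum.cong refl, subst G[symmetric])
      (auto simp: between_def intro!: sum_successive_differences[OF E, symmetric])
  \<comment> \<open>A sample point lies in at most one \<open>A i\<close>, so the sets
    \<open>G i\<close> are disjoint.\<close>
  also have "\<dots> = (\<Sum>e\<in>(\<Union>i\<in>N. G i). F (Min {x\<in>E. e < x}) - F e)"
    using N E disj by (intro sum.UNION_disjoint[symmetric]) (auto simp: G_def)
  also have "(\<Union>i\<in>N. G i) = {e\<in>E. {x\<in>E. e < x} \<noteq> {} \<and> p e \<in> (\<Union>i\<in>N. A i)}"
    by (auto simp: G_def)
  finally show ?thesis .
qed

text \<open>With E containing the endpoints of both families, each side becomes a sum over the gaps
  of E that depends on its family only through the union.\<close>

lemma sum_disjoint_intervals_cong:
  fixes F :: "'a::dense_linorder \<Rightarrow> 'b::ab_group_add"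
    and A :: "'i \<Rightarrow> 'a set" and B :: "'j \<Rightarrow> 'a set"
  assumes N: "finite N" "finite M"
    and A: "\<And>i. i \<in> N \<Longrightarrow> between (A i) (a i) (b i)"
    and B: "\<And>j. j \<in> M \<Longrightarrow> between (B j) (c j) (d j)"
    and disjA: "\<And>i j. i \<in> N \<Longrightarrow> j \<in> N \<Longrightarrow> i \<noteq> j \<Longrightarrow> A i \<inter> A j = {}"
    and disjB: "\<And>i j. i \<in> M \<Longrightarrow> j \<in> M \<Longrightarrow> i \<noteq> j \<Longrightarrow> B i \<inter> B j = {}"
    and U: "(\<Union>i\<in>N. A i) = (\<Union>j\<in>M. B j)"
  shows "(\<Sum>i\<in>N. F (b i) - F (a i)) = (\<Sum>j\<in>M. F (d j) - F (c j))"
proof -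
  define E where "E = a ` N \<union> b ` N \<union> c ` M \<union> d ` M"
  have E: "finite E" using N by (simp add: E_def)
  have "\<exists>q. e < q \<and> q < Min {x\<in>E. e < x}" if "{x\<in>E. e < x} \<noteq> {}" for e
  proof (rule dense)
    show "e < Min {x\<in>E. e < x}" using that E by simp
  qed
  then obtain p where p: "\<And>e. {x\<in>E. e < x} \<noteq> {} \<Longrightarrow> e < p e \<and> p e < Min {x\<in>E. e < x}"
    by metis
  have "(\<Sum>i\<in>N. F (b i) - F (a i)) = (\<Sum>e\<in>{e\<in>E. {x\<in>E. e < x} \<noteq> {} \<and>
      p e \<in> (\<Union>i\<in>N. A i)}. F (Min {x\<in>E. e < x}) - F e)"
    using p by (intro sum_over_disjoint_intervals E N A disjA conjI) (auto simp: E_def)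
  moreover have "(\<Sum>j\<in>M. F (d j) - F (c j)) = (\<Sum>e\<in>{e\<in>E. {x\<in>E. e < x} \<noteq> {} \<and>
      p e \<in> (\<Union>j\<in>M. B j)}. F (Min {x\<in>E. e < x}) - F e)"
    using p by (intro sum_over_disjoint_intervals E N B disjB conjI) (auto simp: E_def)
  ultimately show ?thesis by (simp add: U)
qed

section \<open>Taylor expansion\<close>

text \<open>The functions may depend on \<open>t\<close>, so that one coordinate of a function of several
  variables can be expanded while the others still move.\<close>

lemma taylor_little_o:
  fixes D :: "real \<Rightarrow> nat \<Rightarrow> real \<Rightarrow> real"
  assumes N: "0 < N" "little_o (\<lambda>t. (x t - x 0) ^ N)"
    and D: "\<forall>\<^sub>F t in at_right 0. \<forall>s\<in>closed_segment (x 0) (x t).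
      (\<forall>k<N. (D t k has_real_derivative D t (Suc k) s) (at s)) \<and> \<bar>D t N s\<bar> \<le> C"
  shows "little_o (\<lambda>t. D t 0 (x t) - (\<Sum>k<N. (x t - x 0) ^ k / fact k * D t k (x 0)))"
proof (rule little_o_bound[OF N(2)])
  show "D 0 0 (x 0) - (\<Sum>k<N. (x 0 - x 0) ^ k / fact k * D 0 k (x 0)) = 0"
    using N(1) by (cases N) (auto simp: sum.lessThan_Suc_shift simp del: sum.lessThan_Suc)
  show "\<forall>\<^sub>F t in at_right 0. \<bar>D t 0 (x t) - (\<Sum>k<N. (x t - x 0) ^ k / fact k * D t k (x 0))\<bar>
      \<le> C / fact N * \<bar>(x t - x 0) ^ N\<bar>"
    using D
  proof eventually_elim
    case (elim t)
    show ?case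
    proof (cases "x t = x 0")
      case True
      have "D t 0 (x 0) - (\<Sum>k<N. (x 0 - x 0) ^ k / fact k * D t k (x 0)) = 0"
        using N(1) by (cases N) (auto simp: sum.lessThan_Suc_shift simp del: sum.lessThan_Suc)
      then show ?thesis using N(1) True by (simp add: zero_power)
    next
      case False
      have seg: "closed_segment (x 0) (x t) = {min (x 0) (x t)..max (x 0) (x t)}"
        by (auto simp: closed_segment_eq_real_ivl)
      have "\<exists>s. (if x t < x 0 then x t < s \<and> s < x 0 else x 0 < s \<and> s < x t) \<and>
          D t 0 (x t) = (\<Sum>k<N. D t k (x 0) / fact k * (x t - x 0) ^ k)
            + D t N s / fact N * (x t - x 0) ^ N"
        using elim N(1) False unfolding seg
        by (intro Taylor[of N "D t" "D t 0" "min (x 0) (x t)" "max (x 0) (x t)"]) auto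
      then obtain s where s: "if x t < x 0 then x t < s \<and> s < x 0 else x 0 < s \<and> s < x t"
        "D t 0 (x t) = (\<Sum>k<N. D t k (x 0) / fact k * (x t - x 0) ^ k)
            + D t N s / fact N * (x t - x 0) ^ N"
        by blast
      have "s \<in> closed_segment (x 0) (x t)"
        using s(1) unfolding seg by (auto split: if_splits)
      with elim have "\<bar>D t N s\<bar> \<le> C" by blast
      then have "\<bar>D t N s / fact N * (x t - x 0) ^ N\<bar> \<le> C / fact N * \<bar>(x t - x 0) ^ N\<bar>"
        unfolding abs_mult by (intro mult_right_mono) (simp_all add: divide_right_mono)
      then show ?thesis by (simp add: s(2) mult.commute)
    qed
  qed
qed

text \<open>The function itself is \<open>D 0\<close>. Carrying all its derivatives along as data
  turns differentiation into a shift of the index.\<close>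

definition deriv_chain :: "(nat \<Rightarrow> real \<Rightarrow> real) \<Rightarrow> real set \<Rightarrow> bool" where
  "deriv_chain D V \<longleftrightarrow> (\<forall>n. \<forall>x\<in>V. (D n has_real_derivative D (Suc n) x) (at x))"

lemma deriv_chainD: "deriv_chain D V \<Longrightarrow> x \<in> V \<Longrightarrow> (D n has_real_derivative D (Suc n) x) (at x)"
  by (simp add: deriv_chain_def)

lemma deriv_chain_subset: "deriv_chain D V \<Longrightarrow> W \<subseteq> V \<Longrightarrow> deriv_chain D W"
  by (auto simp: deriv_chain_def)

lemma deriv_chain_isCont: "deriv_chain D V \<Longrightarrow> x \<in> V \<Longrightarrow> isCont (D n) x"
  using deriv_chainD DERIV_isCont by blast

lemma deriv_chain_diff_cmult:
  "deriv_chain D V \<Longrightarrow> deriv_chain G V \<Longrightarrow> deriv_chain (\<lambda>k s. D k s - c * G k s) V"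
  unfolding deriv_chain_def by (auto intro!: derivative_eq_intros)

lemma deriv_chain_taylor:
  assumes D: "deriv_chain D V" "open V" and y: "y \<in> Ro" "y 0 \<in> V"
    and N: "0 < N" "little_o (\<lambda>t. (y t - y 0) ^ N)"
  shows "little_o (\<lambda>t. D k (y t) - (\<Sum>j<N. (y t - y 0) ^ j / fact j * D (k + j) (y 0)))"
proof -
  obtain e where e: "e > 0" "ball (y 0) e \<subseteq> V"
    using D(2) y(2) open_contains_ball by blast
  \<comment> \<open>Continuity of the derivative in the remainder bounds it near \<open>y 0\<close>
    by its absolute value there plus 1.\<close>
  have "isCont (D (k + N)) (y 0)"
    using D(1) y(2) by (rule deriv_chain_isCont)
  then obtain d where d: "d > 0"
    "\<And>s. dist s (y 0) < d \<Longrightarrow> dist (D (k + N) s) (D (k + N) (y 0)) < 1"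
    unfolding continuous_at_eps_delta by (metis zero_less_one)
  have "\<forall>\<^sub>F t in at_right 0. dist (y t) (y 0) < min e d"
    using e d by (intro tendstoD Ro_tendsto y) auto
  then have "\<forall>\<^sub>F t in at_right 0. \<forall>s\<in>closed_segment (y 0) (y t).
      (\<forall>j<N. (D (k + j) has_real_derivative D (k + Suc j) s) (at s)) \<and>
      \<bar>D (k + N) s\<bar> \<le> \<bar>D (k + N) (y 0)\<bar> + 1"
  proof eventually_elim
    case (elim t)
    show ?case
    proof (intro ballI conjI allI impI)
      fix s assume "s \<in> closed_segment (y 0) (y t)"
      then have "dist s (y 0) \<le> dist (y t) (y 0)"
        by (metis dist_commute dist_in_closed_segment)
      with elim have s: "dist s (y 0) < e" "dist s (y 0) < d" by auto
      show "\<bar>D (k + N) s\<bar> \<le> \<bar>D (k + N) (y 0)\<bar> + 1"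
        using d(2)[OF s(2)] by (simp add: dist_real_def)
      have "s \<in> V" using s(1) e(2) by (auto simp: dist_commute)
      then show "(D (k + j) has_real_derivative D (k + Suc j) s) (at s)" for j
        using deriv_chainD[OF D(1)] by simp
    qed
  qed
  from taylor_little_o[OF N, of "\<lambda>t j. D (k + j)", OF this] show ?thesis by simp
qed

text \<open>Up to o(t), a smooth function of y is a polynomial in the increment of y, and
  \<open>Ro\<close> is a ring stable under o(t) errors.\<close>

lemma deriv_chain_Ro:
  assumes D: "deriv_chain D V" "open V" and y: "y \<in> Ro" "y 0 \<in> V"
  shows "(\<lambda>t. D k (y t)) \<in> Ro"
proof -
  have Ro: "(\<lambda>t. y t - y 0) \<in> Ro" by (intro Ro_diff y Ro_const)
  then obtain N where "N > 0" "little_o (\<lambda>t. (y t - y 0) ^ N)"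
    using Ro_nilpotent[OF Ro] by auto
  from deriv_chain_taylor[OF D y this] show ?thesis
    unfolding divide_inverse
    by (rule Ro_cong_little_o[rotated]) (intro Ro_sum Ro_mult Ro_power Ro Ro_const)
qed

definition fapp :: "(real \<Rightarrow> real) \<Rightarrow> fermat \<Rightarrow> fermat" where
  "fapp \<phi> y = abs_fermat (\<lambda>t. \<phi> (rep_fermat y t))"

text \<open>The remainder is bounded by a multiple of the N-th power of the increment, which is
  o(t); in the ring the expansion is therefore exact.\<close>

lemma fapp_taylor:
  assumes D: "deriv_chain D V" "open V" and y: "st y \<in> V"
    and N: "0 < N" "(y - fconst (st y)) ^ N = 0"
  shows "fapp (D k) y = (\<Sum>j<N. (y - fconst (st y)) ^ j * fconst (D (k + j) (st y) / fact j))"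
proof -
  let ?y = "rep_fermat y"
  have Ro: "(\<lambda>t. ?y t - st y) \<in> Ro" by (intro Ro_diff rep_fermat_Ro Ro_const)
  have *: "y - fconst (st y) = abs_fermat (\<lambda>t. ?y t - st y)"
    using abs_fermat_minus[OF rep_fermat_Ro Ro_const] by (simp add: fconst_def abs_rep_fermat)
  have "little_o (\<lambda>t. (?y t - st y) ^ N)"
    using N(2) abs_fermat_eq_iff[OF Ro_power[OF Ro] Ro_const, of N 0]
    by (simp add: * abs_fermat_power Ro zero_fermat_def)
  from deriv_chain_taylor[OF D rep_fermat_Ro _ N(1), of y k] this y
  have "little_o (\<lambda>t. D k (?y t) - (\<Sum>j<N. (?y t - st y) ^ j / fact j * D (k + j) (st y)))"
    by (simp add: st_def)
  then have "little_o (\<lambda>t. D k (?y t) - (\<Sum>j<N. (?y t - st y) ^ j * (D (k + j) (st y) / fact j)))"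
    by simp
  then have "fapp (D k) y = abs_fermat (\<lambda>t. \<Sum>j<N. (?y t - st y) ^ j * (D (k + j) (st y) / fact j))"
    unfolding fapp_def by (intro abs_fermat_eqI Ro_sum Ro_mult Ro_power Ro Ro_const)
  also have "\<dots> = (\<Sum>j<N. abs_fermat (\<lambda>t. (?y t - st y) ^ j * (D (k + j) (st y) / fact j)))"
    by (intro abs_fermat_sum[symmetric] Ro_mult Ro_power Ro Ro_const)
  also have "\<dots> = (\<Sum>j<N. (y - fconst (st y)) ^ j * fconst (D (k + j) (st y) / fact j))"
    unfolding *
    unfolding fconst_def abs_fermat_power[OF Ro] abs_fermat_times[OF Ro_power[OF Ro] Ro_const] ..
  finally show ?thesis .
qed

lemma fapp_fconst:
  assumes D: "deriv_chain D V" "open V" "r \<in> V"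
  shows "fapp (D k) (fconst r) = fconst (D k r)"
  using fapp_taylor[OF D(1,2), of "fconst r" 1 k] D(3) by simp

lemma fapp_Ro:
  assumes "deriv_chain D V" "open V" "st y \<in> V"
  shows "(\<lambda>t. D k (rep_fermat y t)) \<in> Ro"
  using assms by (intro deriv_chain_Ro[OF assms(1,2) rep_fermat_Ro]) (simp add: st_def)

lemma fapp_diff_cmult:
  assumes D: "deriv_chain D V" "deriv_chain G V" "open V" "st y \<in> V"
  shows "fapp (\<lambda>s. D k s - c * G k s) y = fapp (D k) y - fconst c * fapp (G k) y"
  unfolding fapp_def fconst_def
  by (simp add: abs_fermat_times abs_fermat_minus Ro_const Ro_mult
      fapp_Ro[OF D(1,3,4)] fapp_Ro[OF D(2,3,4)])

text \<open>On the open set A all derivatives vanish together with the function, and by continuity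
  they vanish at its closure points inside V. So every Taylor coefficient at \<open>st y\<close> is
  0, whatever the nilpotent part of y.\<close>

lemma fapp_flat:
  assumes D: "deriv_chain D V" "open V" and A: "open A" "A \<subseteq> V" "\<And>r. r \<in> A \<Longrightarrow> D 0 r = 0"
    and y: "st y \<in> V" "st y \<in> closure A"
  shows "fapp (D k) y = 0"
proof -
  have zero: "D k r = 0" if "r \<in> A" for k r
    using that
  proof (induction k arbitrary: r)
    case (Suc k)
    have "((\<lambda>s. 0) has_real_derivative D (Suc k) r) (at r)"
    proof (rule has_field_derivative_transform_within_open)
      show "(D k has_real_derivative D (Suc k) r) (at r)"
        using D(1) Suc.prems A(2) by (auto intro: deriv_chainD)
    qed (use A(1) Suc in auto)
    then show ?case using DERIV_unique[OF _ DERIV_const] by blast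
  qed (rule A(3))
  have zero': "D k (st y) = 0" for k
  proof -
    obtain x where x: "\<And>n. x n \<in> A" "x \<longlonglongrightarrow> st y"
      using y(2) unfolding closure_sequential by blast
    have "(\<lambda>n. D k (x n)) \<longlonglongrightarrow> D k (st y)"
      using deriv_chain_isCont[OF D(1) y(1)] x(2) by (rule isCont_tendsto_compose)
    then show ?thesis
      using zero[OF x(1)] by (simp add: LIMSEQ_const_iff)
  qed
  obtain N where "N > 0" "(y - fconst (st y)) ^ N = 0" using fermat_nilpotent by blast
  from fapp_taylor[OF D y(1) this] show ?thesis
    by (simp add: zero' fconst_simps)
qed

section \<open>Linear combinations of ordinary smooth functions\<close>

text \<open>The coefficients are constants, so the k-th derivative of the combination is obtained by
  shifting every chain by k.\<close>

definition comb :: "(fermat \<times> (nat \<Rightarrow> real \<Rightarrow> real)) list \<Rightarrow> nat \<Rightarrow> fermat \<Rightarrow> fermat" where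
  "comb ws k y = (\<Sum>(w, D)\<leftarrow>ws. w * fapp (D k) y)"

definition deriv_chains :: "(fermat \<times> (nat \<Rightarrow> real \<Rightarrow> real)) list \<Rightarrow> real set \<Rightarrow> bool" where
  "deriv_chains ws V \<longleftrightarrow> (\<forall>(w, D)\<in>set ws. deriv_chain D V)"

lemma comb_simps [simp]:
  "comb [] k y = 0" "comb ((w, D) # ws) k y = w * fapp (D k) y + comb ws k y"
  "comb (us @ ws) k y = comb us k y + comb ws k y"
  by (simp_all add: comb_def)

lemma deriv_chains_simps [simp]:
  "deriv_chains [] V" "deriv_chains ((w, D) # ws) V \<longleftrightarrow> deriv_chain D V \<and> deriv_chains ws V"
  "deriv_chains (us @ ws) V \<longleftrightarrow> deriv_chains us V \<and> deriv_chains ws V"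
  by (auto simp: deriv_chains_def)

lemma deriv_chains_subset: "deriv_chains ws V \<Longrightarrow> W \<subseteq> V \<Longrightarrow> deriv_chains ws W"
  by (auto simp: deriv_chains_def intro: deriv_chain_subset)

lemma comb_uminus: "comb (map (\<lambda>(w, D). (- w, D)) ws) k y = - comb ws k y"
  by (induction ws) auto

lemma deriv_chains_uminus: "deriv_chains (map (\<lambda>(w, D). (- w, D)) ws) V = deriv_chains ws V"
  by (induction ws) auto

lemma comb_diff_cmult:
  assumes "deriv_chains ws V" "deriv_chain D V" "open V" "st y \<in> V"
  shows "comb (map (\<lambda>(w, G). (w, \<lambda>k s. G k s - q G * D k s)) ws) k y
    = comb ws k y - (\<Sum>(w, G)\<leftarrow>ws. w * fconst (q G)) * fapp (D k) y"
  using assms(1)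
  by (induction ws) (auto simp: fapp_diff_cmult[OF _ assms(2-4)] algebra_simps)

text \<open>Gaussian elimination. A term with \<open>D m r \<noteq> 0\<close> has its coefficient
  determined by the others through the relation at r; substituting it shortens the list and replaces
  each other chain G by G minus a real multiple of D. The new list agrees with the old one at every
  order k, not only at m: order 0 serves the uniqueness of derivatives, order 1 the uniqueness of
  primitives.\<close>

lemma comb_eliminate:
  assumes "deriv_chains ws V" "open V" "A \<subseteq> V" "\<And>r. r \<in> A \<Longrightarrow> comb ws m (fconst r) = 0"
  shows "\<exists>vs. deriv_chains vs V \<and> (\<forall>(w, D)\<in>set vs. \<forall>r\<in>A. D m r = 0) \<and>
    (\<forall>k y. st y \<in> V \<longrightarrow> comb ws k y = comb vs k y)"
  using assms(1,4)
proof (induction "length ws" arbitrary: ws rule: less_induct)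
  case less
  show ?case
  proof (cases "\<forall>(w, D)\<in>set ws. \<forall>r\<in>A. D m r = 0")
    case True
    then show ?thesis using less.prems(1) by blast
  next
    case False
    then obtain w D r where D: "(w, D) \<in> set ws" "r \<in> A" "D m r \<noteq> 0" by auto
    then obtain us vs where ws: "ws = us @ (w, D) # vs" by (meson split_list)
    define es where "es = us @ vs"
    define q where "q G = G m r / D m r" for G :: "nat \<Rightarrow> real \<Rightarrow> real"
    define es' where "es' = map (\<lambda>(w, G). (w, \<lambda>k s. G k s - q G * D k s)) es"
    have chain: "deriv_chains es V" "deriv_chain D V"
      using less.prems(1) by (auto simp: ws es_def)
    have comb_ws: "comb ws k y = w * fapp (D k) y + comb es k y" for k y
      by (simp add: ws es_def algebra_simps)
    have "r \<in> V" using D(2) assms(3) by auto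
    \<comment> \<open>The relation at r is solved for w. The divisor \<open>D m r\<close> is a
      nonzero real, so zero divisors do no harm.\<close>
    have "(\<Sum>(w, G)\<leftarrow>es. w * fconst (q G)) = fconst (1 / D m r) * comb es m (fconst r)"
      using chain(1)
    proof (induction es)
      case (Cons wG es)
      obtain v G where wG: "wG = (v, G)" by force
      have "fconst (q G) = fconst (1 / D m r) * fconst (G m r)"
        unfolding fconst_simps(5)[symmetric] by (simp add: q_def)
      then show ?case
        using Cons fapp_fconst[OF _ assms(2) \<open>r \<in> V\<close>] by (simp add: wG algebra_simps)
    qed simp
    also have "comb es m (fconst r) = - w * fconst (D m r)"
      using less.prems(2)[OF D(2)] fapp_fconst[OF chain(2) assms(2) \<open>r \<in> V\<close>]
      by (simp add: comb_ws eq_neg_iff_add_eq_0 add.commute)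
    also have "fconst (1 / D m r) * (- w * fconst (D m r)) = - w * fconst (1 / D m r * D m r)"
      unfolding fconst_simps(5) by (simp add: algebra_simps)
    finally have q: "(\<Sum>(w, G)\<leftarrow>es. w * fconst (q G)) = - w"
      using D(3) by (simp add: fconst_simps)
    have comb_es': "comb ws k y = comb es' k y" if "st y \<in> V" for k y
      unfolding es'_def comb_diff_cmult[OF chain assms(2) that] q comb_ws by simp
    have "length es' < length ws" by (simp add: es'_def es_def ws)
    moreover have "deriv_chains es' V"
      using chain by (auto simp: es'_def deriv_chains_def intro!: deriv_chain_diff_cmult)
    moreover have "comb es' m (fconst r) = 0" if "r \<in> A" for r
      using comb_es'[of "fconst r" m] less.prems(2)[OF that] that assms(3) by auto
    ultimately obtain vs where "deriv_chains vs V" "\<forall>(w, D)\<in>set vs. \<forall>r\<in>A. D m r = 0"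
      "\<forall>k y. st y \<in> V \<longrightarrow> comb es' k y = comb vs k y"
      using less.hyps[of es'] by blast
    then show ?thesis using comb_es' by (intro exI[of _ vs]) auto
  qed
qed

lemma comb_zero_imp_deriv_zero:
  assumes ws: "deriv_chains ws V" "open V" and A: "open A" "A \<subseteq> V"
    and zero: "\<And>r. r \<in> A \<Longrightarrow> comb ws 0 (fconst r) = 0"
    and y: "st y \<in> V" "st y \<in> closure A"
  shows "comb ws k y = 0"
proof -
  obtain vs where vs: "deriv_chains vs V" "\<forall>(w, D)\<in>set vs. \<forall>r\<in>A. D 0 r = 0"
    "\<forall>k y. st y \<in> V \<longrightarrow> comb ws k y = comb vs k y"
    using comb_eliminate[OF ws A(2) zero] by auto
  from vs(1,2) have "comb vs k y = 0"
    by (induction vs) (auto simp: fapp_flat[OF _ ws(2) A _ y])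
  then show ?thesis using vs(3) y(1) by simp
qed

lemma deriv_chain_minus_const:
  "deriv_chain D V \<Longrightarrow> deriv_chain (\<lambda>k s. D k s - (if k = 0 then c else 0)) V"
  unfolding deriv_chain_def by (auto intro!: derivative_eq_intros)

text \<open>Elimination at order 1 leaves functions that are constant on the connected set A. After
  subtraction of its constant each becomes flat, which carries constancy over to the closure and to
  nonstandard points.\<close>

lemma comb_deriv_zero_imp_const:
  assumes ws: "deriv_chains ws V" "open V" and A: "open A" "A \<subseteq> V" "connected A"
    and zero: "\<And>r. r \<in> A \<Longrightarrow> comb ws 1 (fconst r) = 0"
  shows "\<exists>c. \<forall>y. st y \<in> V \<and> st y \<in> closure A \<longrightarrow> comb ws 0 y = c"
proof -
  obtain vs where vs: "deriv_chains vs V" "\<forall>(w, D)\<in>set vs. \<forall>r\<in>A. D 1 r = 0"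
    "\<forall>k y. st y \<in> V \<longrightarrow> comb ws k y = comb vs k y"
    using comb_eliminate[OF ws A(2) zero] by auto
  have const: "\<exists>c. \<forall>y. st y \<in> V \<and> st y \<in> closure A \<longrightarrow> fapp (D 0) y = c"
    if D: "deriv_chain D V" "\<forall>r\<in>A. D 1 r = 0" for D
  proof -
    have "\<exists>c. \<forall>r\<in>A. D 0 r = c"
    proof -
      have deriv: "(D 0 has_real_derivative D 1 r) (at r)" if "r \<in> A" for r
        using deriv_chainD[OF D(1), of r 0] that A(2) by auto
      then have "continuous_on A (D 0)"
        by (intro continuous_at_imp_continuous_on ballI DERIV_isCont)
      with deriv D(2) have "D 0 constant_on A"
        by (intro DERIV_zero_connected_constant_on[OF A(3,1), of "{}"]) auto
      then show ?thesis by (simp add: constant_on_def)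
    qed
    then obtain c where c: "\<forall>r\<in>A. D 0 r = c" by blast
    let ?G = "\<lambda>k s. D k s - (if k = 0 then c else 0)"
    have "fapp (?G 0) y = 0" if "st y \<in> V" "st y \<in> closure A" for y
      using c by (intro fapp_flat[OF deriv_chain_minus_const[OF D(1)] ws(2) A(1,2) _ that]) auto
    moreover have "fapp (?G 0) y = fapp (D 0) y - fconst c" if "st y \<in> V" for y
      unfolding fapp_def fconst_def using fapp_Ro[OF D(1) ws(2) that]
      by (simp add: abs_fermat_minus Ro_const)
    ultimately show ?thesis by (intro exI[of _ "fconst c"]) auto
  qed
  from vs(1,2) have "\<exists>c. \<forall>y. st y \<in> V \<and> st y \<in> closure A \<longrightarrow> comb vs 0 y = c"
  proof (induction vs)
    case (Cons wD vs)
    obtain w D where wD: "wD = (w, D)" by force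
    obtain c where "\<forall>y. st y \<in> V \<and> st y \<in> closure A \<longrightarrow> fapp (D 0) y = c"
      using const[of D] Cons.prems by (auto simp: wD)
    moreover obtain c' where "\<forall>y. st y \<in> V \<and> st y \<in> closure A \<longrightarrow> comb vs 0 y = c'"
      using Cons by (auto simp: wD)
    ultimately show ?case by (intro exI[of _ "w * c + c'"]) (auto simp: wD)
  qed auto
  then show ?thesis using vs(3) by auto
qed

section \<open>Functions of several variables\<close>

text \<open>Only the first d coordinates vary on \<open>Rd d\<close>, so finitely many radii matter
  and have a positive minimum.\<close>

lemma openin_Rd_box:
  assumes "openin (top_of_set (Rd d)) U" "c \<in> U"
  shows "\<exists>\<delta>>0. \<forall>z\<in>Rd d. (\<forall>i<d. \<bar>z i - c i\<bar> < \<delta>) \<longrightarrow> z \<in> U"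
proof -
  obtain W where W: "open W" "U = Rd d \<inter> W"
    using assms(1) by (auto simp: openin_open)
  then have "openin (product_topology (\<lambda>i. euclidean) UNIV) W" "c \<in> W"
    using assms(2) by (auto simp: open_fun_def)
  from product_topology_open_contains_basis[OF this]
  obtain X where X: "c \<in> (\<Pi>\<^sub>E i\<in>UNIV. X i)" "\<And>i. open (X i :: real set)"
    "(\<Pi>\<^sub>E i\<in>UNIV. X i) \<subseteq> W"
    by auto
  have "\<exists>\<epsilon>>0. ball (c i) \<epsilon> \<subseteq> X i" for i
    using X(1,2) open_contains_ball by (metis PiE_mem UNIV_I)
  then obtain \<epsilon> where \<epsilon>: "\<And>i. \<epsilon> i > 0" "\<And>i. ball (c i) (\<epsilon> i) \<subseteq> X i" by metis
  \<comment> \<open>The element 1 keeps the set nonempty when d = 0.\<close>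
  define \<delta> where "\<delta> = Min (insert 1 (\<epsilon> ` {..<d}))"
  have "\<delta> > 0" using \<epsilon>(1) by (auto simp: \<delta>_def)
  moreover have "z \<in> U" if z: "z \<in> Rd d" "\<forall>i<d. \<bar>z i - c i\<bar> < \<delta>" for z
  proof -
    have "z i \<in> X i" for i
    proof (cases "i < d")
      case True
      then have "\<delta> \<le> \<epsilon> i" by (auto simp: \<delta>_def intro: Min_le)
      with z(2) True have "z i \<in> ball (c i) (\<epsilon> i)"
        by (auto simp: dist_real_def abs_minus_commute)
      then show ?thesis using \<epsilon>(2) by blast
    next
      case False
      then have "z i = c i" using z(1) assms(2) W(2) by (auto simp: Rd_def)
      then show ?thesis using X(1) by auto
    qed
    then show ?thesis using X(3) W(2) z(1) by auto
  qed
  ultimately show ?thesis by blast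
qed

lemma continuous_on_Rd_box:
  assumes U: "openin (top_of_set (Rd d)) U" "c \<in> U" and g: "continuous_on U g" and "0 < \<epsilon>"
  shows "\<exists>\<delta>>0. \<forall>z\<in>Rd d. (\<forall>i<d. \<bar>z i - c i\<bar> < \<delta>) \<longrightarrow> z \<in> U \<and> \<bar>g z - g c\<bar> < (\<epsilon>::real)"
proof -
  have "openin (top_of_set U) (U \<inter> g -` ball (g c) \<epsilon>)"
    using g by (intro continuous_openin_preimage_gen) auto
  then have "openin (top_of_set (Rd d)) (U \<inter> g -` ball (g c) \<epsilon>)"
    using U(1) openin_trans by blast
  moreover have "c \<in> U \<inter> g -` ball (g c) \<epsilon>" using U(2) \<open>0 < \<epsilon>\<close> by simp
  ultimately obtain \<delta> where "\<delta> > 0"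
    "\<forall>z\<in>Rd d. (\<forall>i<d. \<bar>z i - c i\<bar> < \<delta>) \<longrightarrow> z \<in> U \<inter> g -` ball (g c) \<epsilon>"
    using openin_Rd_box by blast
  then show ?thesis
    by (intro exI[of _ \<delta>]) (auto simp: dist_real_def abs_minus_commute)
qed

text \<open>Schwarz's theorem in the plane. Two applications of the mean value theorem to the second
  difference of g over a square of side h give h^2 times \<open>gxy\<close> at one of its points,
  and in the other order h^2 times \<open>gyx\<close> at another; continuity brings both points to
  (a, b).\<close>

lemma symmetric_second_derivative:
  fixes g gx gy gxy gyx :: "real \<Rightarrow> real \<Rightarrow> real"
  assumes r: "0 < r"
    and gx: "\<And>u v. \<bar>u - a\<bar> < r \<Longrightarrow> \<bar>v - b\<bar> < r \<Longrightarrow> ((\<lambda>s. g s v) has_real_derivative gx u v) (at u)"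
    and gy: "\<And>u v. \<bar>u - a\<bar> < r \<Longrightarrow> \<bar>v - b\<bar> < r \<Longrightarrow> ((\<lambda>s. g u s) has_real_derivative gy u v) (at v)"
    and gxy: "\<And>u v. \<bar>u - a\<bar> < r \<Longrightarrow> \<bar>v - b\<bar> < r \<Longrightarrow> ((\<lambda>s. gx u s) has_real_derivative gxy u v) (at v)"
    and gyx: "\<And>u v. \<bar>u - a\<bar> < r \<Longrightarrow> \<bar>v - b\<bar> < r \<Longrightarrow> ((\<lambda>s. gy s v) has_real_derivative gyx u v) (at u)"
    and cont: "\<And>\<epsilon>. 0 < \<epsilon> \<Longrightarrow> \<exists>\<delta>>0. \<forall>u v. \<bar>u - a\<bar> < \<delta> \<and> \<bar>v - b\<bar> < \<delta> \<longrightarrow>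
      \<bar>gxy u v - gxy a b\<bar> < \<epsilon> \<and> \<bar>gyx u v - gyx a b\<bar> < \<epsilon>"
  shows "gxy a b = gyx a b"
proof (rule ccontr)
  assume "gxy a b \<noteq> gyx a b"
  define \<epsilon> where "\<epsilon> = \<bar>gxy a b - gyx a b\<bar> / 2"
  have "\<epsilon> > 0" using \<open>gxy a b \<noteq> gyx a b\<close> by (simp add: \<epsilon>_def)
  then obtain \<delta> where \<delta>: "\<delta> > 0" "\<And>u v. \<bar>u - a\<bar> < \<delta> \<Longrightarrow> \<bar>v - b\<bar> < \<delta> \<Longrightarrow>
      \<bar>gxy u v - gxy a b\<bar> < \<epsilon> \<and> \<bar>gyx u v - gyx a b\<bar> < \<epsilon>"
    using cont by blast
  define h where "h = min r \<delta> / 2"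
  have h: "0 < h" "h < r" "h < \<delta>" using r \<delta>(1) by (auto simp: h_def)
  have "\<exists>\<xi>>a. \<xi> < a + h \<and> (g (a + h) (b + h) - g (a + h) b) - (g a (b + h) - g a b)
      = (a + h - a) * (gx \<xi> (b + h) - gx \<xi> b)"
    using h by (intro MVT2[of a "a + h" "\<lambda>u. g u (b + h) - g u b" "\<lambda>u. gx u (b + h) - gx u b"]
        DERIV_diff gx) auto
  then obtain \<xi> where \<xi>: "a < \<xi>" "\<xi> < a + h" "(g (a + h) (b + h) - g (a + h) b) - (g a (b + h) - g a b)
      = h * (gx \<xi> (b + h) - gx \<xi> b)" by auto
  have "\<exists>\<eta>>b. \<eta> < b + h \<and> gx \<xi> (b + h) - gx \<xi> b = (b + h - b) * gxy \<xi> \<eta>"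
    using h \<xi> by (intro MVT2 gxy) auto
  then obtain \<eta> where \<eta>: "b < \<eta>" "\<eta> < b + h" "gx \<xi> (b + h) - gx \<xi> b = h * gxy \<xi> \<eta>" by auto
  have "\<exists>\<eta>'>b. \<eta>' < b + h \<and> (g (a + h) (b + h) - g a (b + h)) - (g (a + h) b - g a b)
      = (b + h - b) * (gy (a + h) \<eta>' - gy a \<eta>')"
    using h by (intro MVT2[of b "b + h" "\<lambda>v. g (a + h) v - g a v" "\<lambda>v. gy (a + h) v - gy a v"]
        DERIV_diff gy) auto
  then obtain \<eta>' where \<eta>': "b < \<eta>'" "\<eta>' < b + h" "(g (a + h) (b + h) - g a (b + h)) - (g (a + h) b - g a b)
      = h * (gy (a + h) \<eta>' - gy a \<eta>')" by auto
  have "\<exists>\<xi>'>a. \<xi>' < a + h \<and> gy (a + h) \<eta>' - gy a \<eta>' = (a + h - a) * gyx \<xi>' \<eta>'"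
    using h \<eta>' by (intro MVT2[of a "a + h" "\<lambda>u. gy u \<eta>'"] gyx) auto
  then obtain \<xi>' where \<xi>': "a < \<xi>'" "\<xi>' < a + h" "gy (a + h) \<eta>' - gy a \<eta>' = h * gyx \<xi>' \<eta>'"
    by auto
  have "h * (h * gxy \<xi> \<eta>) = h * (h * gyx \<xi>' \<eta>')"
    unfolding \<eta>(3)[symmetric] \<xi>(3)[symmetric] \<xi>'(3)[symmetric] \<eta>'(3)[symmetric] by simp
  then have "gxy \<xi> \<eta> = gyx \<xi>' \<eta>'" using h by simp
  moreover have "\<bar>gxy \<xi> \<eta> - gxy a b\<bar> < \<epsilon>" using \<delta>(2)[of \<xi> \<eta>] \<xi> \<eta> h by auto
  moreover have "\<bar>gyx \<xi>' \<eta>' - gyx a b\<bar> < \<epsilon>" using \<delta>(2)[of \<xi>' \<eta>'] \<xi>' \<eta>' h by auto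
  ultimately show False by (simp add: \<epsilon>_def abs_if split: if_splits)
qed

text \<open>The list records the directions of differentiation, the most recent one first. Symmetry
  is not built in: it is derived in \<open>partials_commute\<close>.\<close>

definition partials :: "nat \<Rightarrow> (nat \<Rightarrow> real) set \<Rightarrow> (nat list \<Rightarrow> (nat \<Rightarrow> real) \<Rightarrow> real) \<Rightarrow> bool" where
  "partials d U D \<longleftrightarrow> (\<forall>ks. set ks \<subseteq> {..<d} \<longrightarrow> continuous_on U (D ks) \<and>
     (\<forall>i<d. \<forall>z\<in>U. ((\<lambda>s. D ks (z(i := s))) has_real_derivative D (i # ks) z) (at (z i))))"

lemma partials_cont: "partials d U D \<Longrightarrow> set ks \<subseteq> {..<d} \<Longrightarrow> continuous_on U (D ks)"
  by (simp add: partials_def)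

lemma partials_deriv:
  assumes "partials d U D" "set ks \<subseteq> {..<d}" "i < d" "z(i := u) \<in> U"
  shows "((\<lambda>s. D ks (z(i := s))) has_real_derivative D (i # ks) (z(i := u))) (at u)"
proof -
  have "((\<lambda>s. D ks ((z(i := u))(i := s))) has_real_derivative D (i # ks) (z(i := u))) (at ((z(i := u)) i))"
    using assms unfolding partials_def by blast
  then show ?thesis by simp
qed

lemma Rd_upd: "z \<in> Rd d \<Longrightarrow> i < d \<Longrightarrow> z(i := s) \<in> Rd d"
  by (auto simp: Rd_def)

lemma partials_commute:
  assumes D: "partials d U D" and U: "openin (top_of_set (Rd d)) U" "z \<in> U"
    and ks: "set ks \<subseteq> {..<d}" and ij: "i < d" "j < d"
  shows "D (i # j # ks) z = D (j # i # ks) z"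
proof (cases "i = j")
  case False
  let ?z = "\<lambda>u v. z(i := u, j := v)"
  have zRd: "?z u v \<in> Rd d" for u v
    using U openin_subset[OF U(1)] ij by (intro Rd_upd) auto
  have z: "?z (z i) (z j) = z" by simp
  have near: "\<forall>k<d. \<bar>?z u v k - z k\<bar> < \<delta>" if "\<bar>u - z i\<bar> < \<delta>" "\<bar>v - z j\<bar> < \<delta>" for u v \<delta>
    using that by auto
  obtain r where r: "r > 0" "\<forall>w\<in>Rd d. (\<forall>k<d. \<bar>w k - z k\<bar> < r) \<longrightarrow> w \<in> U"
    using openin_Rd_box[OF U] by blast
  then have inU: "?z u v \<in> U" if "\<bar>u - z i\<bar> < r" "\<bar>v - z j\<bar> < r" for u v
    using near[OF that] zRd by blast
  have *: "((\<lambda>s. D l (?z s v)) has_real_derivative D (i # l) (?z u v)) (at u)"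
    "((\<lambda>s. D l (?z u s)) has_real_derivative D (j # l) (?z u v)) (at v)"
    if "set l \<subseteq> {..<d}" "\<bar>u - z i\<bar> < r" "\<bar>v - z j\<bar> < r" for l u v
    using partials_deriv[OF D that(1) ij(1), of "z(j := v)" u]
      partials_deriv[OF D that(1) ij(2), of "z(i := u)" v] inU[OF that(2,3)] False
    by (simp_all add: fun_upd_twist)
  have "D (j # i # ks) (?z (z i) (z j)) = D (i # j # ks) (?z (z i) (z j))"
  proof (rule symmetric_second_derivative[OF r(1), where g = "\<lambda>u v. D ks (?z u v)"
        and gx = "\<lambda>u v. D (i # ks) (?z u v)" and gy = "\<lambda>u v. D (j # ks) (?z u v)"
        and gxy = "\<lambda>u v. D (j # i # ks) (?z u v)" and gyx = "\<lambda>u v. D (i # j # ks) (?z u v)"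
        and a = "z i" and b = "z j"])
    fix \<epsilon> :: real assume "0 < \<epsilon>"
    obtain \<delta> where \<delta>: "\<delta> > 0"
      "\<forall>w\<in>Rd d. (\<forall>k<d. \<bar>w k - z k\<bar> < \<delta>) \<longrightarrow> w \<in> U \<and> \<bar>D (j # i # ks) w - D (j # i # ks) z\<bar> < \<epsilon>"
      using continuous_on_Rd_box[OF U partials_cont[OF D] \<open>0 < \<epsilon>\<close>, of "j # i # ks"] ks ij by auto
    obtain \<delta>' where \<delta>': "\<delta>' > 0"
      "\<forall>w\<in>Rd d. (\<forall>k<d. \<bar>w k - z k\<bar> < \<delta>') \<longrightarrow> w \<in> U \<and> \<bar>D (i # j # ks) w - D (i # j # ks) z\<bar> < \<epsilon>"
      using continuous_on_Rd_box[OF U partials_cont[OF D] \<open>0 < \<epsilon>\<close>, of "i # j # ks"] ks ij by auto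
    have "\<bar>D (j # i # ks) (?z u v) - D (j # i # ks) (?z (z i) (z j))\<bar> < \<epsilon> \<and>
        \<bar>D (i # j # ks) (?z u v) - D (i # j # ks) (?z (z i) (z j))\<bar> < \<epsilon>"
      if "\<bar>u - z i\<bar> < min \<delta> \<delta>'" "\<bar>v - z j\<bar> < min \<delta> \<delta>'" for u v
    proof -
      have "\<forall>k<d. \<bar>?z u v k - z k\<bar> < \<delta>" "\<forall>k<d. \<bar>?z u v k - z k\<bar> < \<delta>'"
        using near[OF that] by auto
      with \<delta>(2) \<delta>'(2) zRd[of u v] show ?thesis unfolding z by blast
    qed
    with \<delta>(1) \<delta>'(1) show "\<exists>\<delta>>0. \<forall>u v. \<bar>u - z i\<bar> < \<delta> \<and> \<bar>v - z j\<bar> < \<delta> \<longrightarrow>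
        \<bar>D (j # i # ks) (?z u v) - D (j # i # ks) (?z (z i) (z j))\<bar> < \<epsilon> \<and>
        \<bar>D (i # j # ks) (?z u v) - D (i # j # ks) (?z (z i) (z j))\<bar> < \<epsilon>"
      by (intro exI[of _ "min \<delta> \<delta>'"]) auto
  next
    fix u v assume uv: "\<bar>u - z i\<bar> < r" "\<bar>v - z j\<bar> < r"
    show "((\<lambda>s. D ks (?z s v)) has_real_derivative D (i # ks) (?z u v)) (at u)"
      by (rule *(1)[OF ks uv])
    show "((\<lambda>s. D ks (?z u s)) has_real_derivative D (j # ks) (?z u v)) (at v)"
      by (rule *(2)[OF ks uv])
    show "((\<lambda>s. D (i # ks) (?z u s)) has_real_derivative D (j # i # ks) (?z u v)) (at v)"
      using ks ij by (intro *(2) uv) auto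
    show "((\<lambda>s. D (j # ks) (?z s v)) has_real_derivative D (i # j # ks) (?z u v)) (at u)"
      using ks ij by (intro *(1) uv) auto
  qed
  then show ?thesis by simp
qed simp

text \<open>Expanding the x-derivative in the parameters puts the direction x innermost, while the
  derivative of a combination has it outermost; this lemma reconciles the two.\<close>

lemma partials_rotate:
  assumes D: "partials d U D" and U: "openin (top_of_set (Rd d)) U"
    and l: "set l \<subseteq> {..<d}" and i: "i < d"
  shows "z \<in> U \<Longrightarrow> D (l @ [i]) z = D (i # l) z"
  using l
proof (induction l arbitrary: z)
  case (Cons j l)
  have j: "j < d" and l: "set l \<subseteq> {..<d}" using Cons.prems by auto
  obtain r where r: "r > 0" "\<forall>w\<in>Rd d. (\<forall>k<d. \<bar>w k - z k\<bar> < r) \<longrightarrow> w \<in> U"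
    using openin_Rd_box[OF U Cons.prems(1)] by blast
  \<comment> \<open>The induction hypothesis is needed on a whole neighbourhood along the j-axis,
    since two functions must agree there to have the same j-derivative.\<close>
  have inU: "z(j := s) \<in> U" if "s \<in> ball (z j) r" for s
  proof -
    have "z(j := s) \<in> Rd d"
      using openin_subset[OF U] Cons.prems(1) j by (intro Rd_upd) auto
    moreover have "\<forall>k<d. \<bar>(z(j := s)) k - z k\<bar> < r"
      using that r(1) by (auto simp: dist_real_def abs_minus_commute)
    ultimately show ?thesis using r(2) by blast
  qed
  have "((\<lambda>s. D (l @ [i]) (z(j := s))) has_real_derivative D (j # l @ [i]) (z(j := z j))) (at (z j))"
    using Cons.prems l i j by (intro partials_deriv[OF D]) auto
  then have 1: "((\<lambda>s. D (l @ [i]) (z(j := s))) has_real_derivative D (j # l @ [i]) z) (at (z j))"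
    by simp
  have "((\<lambda>s. D (i # l) (z(j := s))) has_real_derivative D (j # i # l) (z(j := z j))) (at (z j))"
    using Cons.prems l i j by (intro partials_deriv[OF D]) auto
  then have "((\<lambda>s. D (i # l) (z(j := s))) has_real_derivative D (j # i # l) z) (at (z j))"
    by simp
  then have "((\<lambda>s. D (l @ [i]) (z(j := s))) has_real_derivative D (j # i # l) z) (at (z j))"
  proof (rule has_field_derivative_transform_within_open)
    show "z j \<in> ball (z j) r" using r(1) by simp
    show "D (i # l) (z(j := s)) = D (l @ [i]) (z(j := s))" if "s \<in> ball (z j) r" for s
      by (rule Cons.IH[OF inU[OF that] l, symmetric])
  qed simp
  with 1 have "D (j # l @ [i]) z = D (j # i # l) z" by (rule DERIV_unique)
  then show ?case using partials_commute[OF D U Cons.prems(1) l j i] by simp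
qed simp

lemma openin_prodPV:
  assumes "open_Rd pd P" "open V"
  shows "openin (top_of_set (Rd (Suc pd))) (prodPV pd P V)"
proof -
  obtain W where W: "open W" "P = Rd pd \<inter> W"
    using assms(1) by (auto simp: open_Rd_def openin_open)
  have "continuous_on UNIV (\<lambda>z::nat \<Rightarrow> real. z(pd := 0))"
  proof (rule continuous_on_coordinatewise_then_product)
    show "continuous_on UNIV (\<lambda>z::nat \<Rightarrow> real. (z(pd := 0)) i)" for i
      by (cases "i = pd") (auto intro: continuous_on_product_coordinates)
  qed
  then have "open ((\<lambda>z. z(pd := 0)) -` W \<inter> UNIV)"
    using W(1) by (simp add: continuous_on_open_vimage)
  moreover have "open ((\<lambda>z::nat \<Rightarrow> real. z pd) -` V)"
    using assms(2) continuous_on_open_vimage[of UNIV "\<lambda>z::nat \<Rightarrow> real. z pd"]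
      continuous_on_product_coordinates by auto
  ultimately have "open ((\<lambda>z. z(pd := 0)) -` W \<inter> (\<lambda>z. z pd) -` V)" by (auto intro: open_Int)
  moreover have "prodPV pd P V = Rd (Suc pd) \<inter> ((\<lambda>z. z(pd := 0)) -` W \<inter> (\<lambda>z. z pd) -` V)"
    by (auto simp: prodPV_def W(2) Rd_def)
  ultimately show ?thesis by (auto simp: openin_open)
qed

section \<open>Taylor expansion in the parameters\<close>

lemma little_o_eventually_eq:
  assumes "\<forall>\<^sub>F t in at_right 0. f t = g t" "f 0 = g 0"
  shows "little_o (\<lambda>t. f t - g t)"
proof -
  have "\<forall>\<^sub>F t in at_right 0. 0 = (f t - g t) / t"
    using assms(1) by eventually_elim simp
  with assms(2) show ?thesis
    unfolding little_o_def by (auto intro: Lim_transform_eventually[OF tendsto_const])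
qed

lemma fapp_cong:
  assumes V: "open V" "st y \<in> V" and eq: "\<And>s. s \<in> V \<Longrightarrow> \<phi> s = \<psi> s"
    and Ro: "(\<lambda>t. \<psi> (rep_fermat y t)) \<in> Ro"
  shows "fapp \<phi> y = fapp \<psi> y"
  unfolding fapp_def
proof (rule abs_fermat_eqI[OF Ro], rule little_o_eventually_eq)
  have "\<forall>\<^sub>F t in at_right 0. rep_fermat y t \<in> V"
    using V by (intro topological_tendstoD[OF Ro_tendsto[OF rep_fermat_Ro]]) (auto simp: st_def)
  then show "\<forall>\<^sub>F t in at_right 0. \<phi> (rep_fermat y t) = \<psi> (rep_fermat y t)"
    by eventually_elim (rule eq)
  show "\<phi> (rep_fermat y 0) = \<psi> (rep_fermat y 0)" using V(2) eq by (simp add: st_def)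
qed

text \<open>The parameters are expanded one at a time, by lowering \<open>j\<close> from \<open>pd\<close> to \<open>0\<close>.\<close>

definition frozen :: "nat \<Rightarrow> (nat \<Rightarrow> fermat) \<Rightarrow> fermat \<Rightarrow> nat \<Rightarrow> real \<Rightarrow> nat \<Rightarrow> real" where
  "frozen pd p y j t = (\<lambda>i. if i < j then st (p i) else if i < pd then rep_fermat (p i) t else 0)
     (pd := rep_fermat y t)"

lemma frozen_zero: "frozen pd p y j 0 = (stp pd p)(pd := st y)" if "j \<le> pd"
  using that by (auto simp: frozen_def stp_def st_def fun_eq_iff)

lemma eventually_frozen_near:
  assumes "j \<le> pd" "0 < \<delta>"
  shows "\<forall>\<^sub>F t in at_right 0. \<forall>i<Suc pd. \<bar>frozen pd p y j t i - ((stp pd p)(pd := st y)) i\<bar> < \<delta>"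
proof -
  have near: "\<forall>\<^sub>F t in at_right 0. \<bar>rep_fermat x t - st x\<bar> < \<delta>" for x
    using tendstoD[OF Ro_tendsto[OF rep_fermat_Ro] assms(2)] by (simp add: dist_real_def st_def)
  have "\<forall>\<^sub>F t in at_right 0. \<forall>i\<in>{..<pd}. \<bar>rep_fermat (p i) t - st (p i)\<bar> < \<delta>"
    using near by (intro eventually_ball_finite) auto
  then show ?thesis
    using near[of y] by eventually_elim (use assms in \<open>auto simp: frozen_def stp_def less_Suc_eq\<close>)
qed

lemma frozen_Rd: "j \<le> pd \<Longrightarrow> frozen pd p y j t \<in> Rd (Suc pd)"
  by (auto simp: frozen_def Rd_def)

text \<open>Coordinate j is expanded at its standard part while the later parameters and the
  variable still move with t; this is the case for which \<open>taylor_little_o\<close> admits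
  functions depending on t.\<close>

lemma frozen_step_taylor:
  assumes D: "partials (Suc pd) U D" and U: "openin (top_of_set (Rd (Suc pd))) U"
    and y: "(stp pd p)(pd := st y) \<in> U" and ks: "set ks \<subseteq> {..pd}" and j: "j < pd"
    and N: "0 < N" "little_o (\<lambda>t. (rep_fermat (p j) t - st (p j)) ^ N)"
  shows "little_o (\<lambda>t. D ks (frozen pd p y j t) - (\<Sum>k<N. (rep_fermat (p j) t - st (p j)) ^ k / fact k *
    D (replicate k j @ ks) (frozen pd p y (Suc j) t)))"
proof -
  let ?x = "rep_fermat (p j)" and ?c = "(stp pd p)(pd := st y)"
  let ?E = "\<lambda>t k s. D (replicate k j @ ks) ((frozen pd p y (Suc j) t)(j := s))"
  have sub: "set (replicate k j @ ks) \<subseteq> {..<Suc pd}" for k using ks j by auto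
  \<comment> \<open>Continuity at the standard point bounds the N-th derivative on a box, hence
    uniformly in t once the moving point has entered it.\<close>
  obtain \<delta> where \<delta>: "\<delta> > 0" "\<forall>z\<in>Rd (Suc pd). (\<forall>i<Suc pd. \<bar>z i - ?c i\<bar> < \<delta>) \<longrightarrow>
      z \<in> U \<and> \<bar>D (replicate N j @ ks) z - D (replicate N j @ ks) ?c\<bar> < 1"
    using continuous_on_Rd_box[OF U y partials_cont[OF D sub] zero_less_one] by blast
  have "\<forall>\<^sub>F t in at_right 0. \<bar>?x t - st (p j)\<bar> < \<delta>"
    using tendstoD[OF Ro_tendsto[OF rep_fermat_Ro] \<delta>(1)] by (simp add: dist_real_def st_def)
  moreover have "\<forall>\<^sub>F t in at_right 0. \<forall>i<Suc pd. \<bar>frozen pd p y (Suc j) t i - ?c i\<bar> < \<delta>"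
    using j \<delta>(1) by (intro eventually_frozen_near) auto
  ultimately have "\<forall>\<^sub>F t in at_right 0. \<forall>s\<in>closed_segment (?x 0) (?x t).
      (\<forall>k<N. (?E t k has_real_derivative ?E t (Suc k) s) (at s)) \<and>
      \<bar>?E t N s\<bar> \<le> \<bar>D (replicate N j @ ks) ?c\<bar> + 1"
  proof eventually_elim
    case (elim t)
    show ?case
    proof (intro ballI conjI allI impI)
      fix s assume "s \<in> closed_segment (?x 0) (?x t)"
      then have "\<bar>s - ?x 0\<bar> \<le> \<bar>?x t - ?x 0\<bar>"
        by (auto simp: closed_segment_eq_real_ivl split: if_splits)
      then have s: "\<bar>s - st (p j)\<bar> < \<delta>" using elim(1) by (simp add: st_def)
      let ?z = "(frozen pd p y (Suc j) t)(j := s)"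
      have "?z \<in> Rd (Suc pd)" using j by (intro Rd_upd frozen_Rd) auto
      moreover have "\<forall>i<Suc pd. \<bar>?z i - ?c i\<bar> < \<delta>"
        using elim(2) s j by (auto simp: stp_def)
      ultimately have z: "?z \<in> U" "\<bar>D (replicate N j @ ks) ?z - D (replicate N j @ ks) ?c\<bar> < 1"
        using \<delta>(2) by blast+
      then show "\<bar>?E t N s\<bar> \<le> \<bar>D (replicate N j @ ks) ?c\<bar> + 1" by linarith
      show "(?E t k has_real_derivative ?E t (Suc k) s) (at s)" for k
        using partials_deriv[OF D sub _ z(1), of k] j by simp
    qed
  qed
  from taylor_little_o[OF N(1), of ?x ?E, OF _ this] N(2)
  have *: "little_o (\<lambda>t. ?E t 0 (?x t) - (\<Sum>k<N. (?x t - ?x 0) ^ k / fact k * ?E t k (?x 0)))"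
    by (simp add: st_def)
  have "(frozen pd p y (Suc j) t)(j := ?x t) = frozen pd p y j t"
    "(frozen pd p y (Suc j) t)(j := ?x 0) = frozen pd p y (Suc j) t" for t
    using j by (auto simp: frozen_def st_def fun_eq_iff)
  with * show ?thesis by (simp add: st_def)
qed

lemma deriv_chain_slice:
  assumes D: "partials (Suc pd) (prodPV pd P V) D" and c: "c \<in> P" "P \<subseteq> Rd pd"
    and ks: "set ks \<subseteq> {..pd}"
  shows "deriv_chain (\<lambda>k s. D (replicate k pd @ ks) (c(pd := s))) V"
  unfolding deriv_chain_def
proof (intro allI ballI)
  fix k s assume "s \<in> V"
  have "c pd = 0" using c by (auto simp: Rd_def)
  then have cpd: "c(pd := 0) = c" by (metis fun_upd_triv)
  have "c(pd := s) \<in> prodPV pd P V"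
    using c \<open>s \<in> V\<close> cpd by (auto simp: prodPV_def Rd_def)
  moreover have "set (replicate k pd @ ks) \<subseteq> {..<Suc pd}" using ks by auto
  ultimately show "((\<lambda>s. D (replicate k pd @ ks) (c(pd := s))) has_real_derivative
      D (replicate (Suc k) pd @ ks) (c(pd := s))) (at s)"
    using partials_deriv[OF D, of "replicate k pd @ ks" pd c s] by simp
qed

lemma sum_list_concat_upt:
  fixes f :: "'a \<Rightarrow> 'b::comm_monoid_add"
  shows "(\<Sum>x\<leftarrow>concat (map F [0..<N]). f x) = (\<Sum>k<N. \<Sum>x\<leftarrow>F k. f x)"
  by (induction N) (simp_all add: add.commute)

text \<open>A pair (w, l) is one Taylor term: w collects powers of parameter increments over
  factorials, l lists the parameter directions differentiated. The list \<open>ks\<close> stands for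
  derivatives taken before the expansion.\<close>

definition taylor_sum where
  "taylor_sum D pd c L ks y = (\<Sum>(w, l)\<leftarrow>L. w * fapp (\<lambda>s. D (l @ ks) (c(pd := s))) y)"

text \<open>The quantifier order matters: one list L serves all \<open>ks\<close> and y, so a
  function and its x-derivative are expanded with the same coefficients.\<close>

lemma frozen_expansion:
  assumes D: "partials (Suc pd) (prodPV pd P V) D" and P: "open_Rd pd P" "stp pd p \<in> P"
    and V: "open V" and j: "j \<le> pd"
  shows "\<exists>L. (\<forall>(w, l)\<in>set L. set l \<subseteq> {..<pd}) \<and>
    (\<forall>ks y. set ks \<subseteq> {..pd} \<longrightarrow> st y \<in> V \<longrightarrow> (\<lambda>t. D ks (frozen pd p y j t)) \<in> Ro \<and>
      abs_fermat (\<lambda>t. D ks (frozen pd p y j t)) = taylor_sum D pd (stp pd p) L ks y)"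
  using j
proof (induction rule: inc_induct)
  case base
  have "frozen pd p y pd t = (stp pd p)(pd := rep_fermat y t)" for y t
    by (auto simp: frozen_def stp_def fun_eq_iff)
  moreover have "(\<lambda>t. D ks ((stp pd p)(pd := rep_fermat y t))) \<in> Ro"
    if "set ks \<subseteq> {..pd}" "st y \<in> V" for ks y
    using fapp_Ro[OF deriv_chain_slice[OF D P(2) _ that(1)] V that(2), of 0] P(1)
    by (simp add: open_Rd_def)
  ultimately show ?case
    by (intro exI[of _ "[(1, [])]"]) (simp add: taylor_sum_def fapp_def del: fun_upd_apply)
next
  case (step j)
  let ?c = "stp pd p"
  obtain L where L: "\<forall>(w, l)\<in>set L. set l \<subseteq> {..<pd}"
    "\<And>ks y. set ks \<subseteq> {..pd} \<Longrightarrow> st y \<in> V \<Longrightarrow> (\<lambda>t. D ks (frozen pd p y (Suc j) t)) \<in> Ro"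
    "\<And>ks y. set ks \<subseteq> {..pd} \<Longrightarrow> st y \<in> V \<Longrightarrow>
      abs_fermat (\<lambda>t. D ks (frozen pd p y (Suc j) t)) = taylor_sum D pd ?c L ks y"
    using step.IH by blast
  let ?x = "\<lambda>t. rep_fermat (p j) t - st (p j)"
  have x: "?x \<in> Ro" by (intro Ro_diff rep_fermat_Ro Ro_const)
  \<comment> \<open>The order of nilpotency depends on the parameter \<open>p j\<close> alone, which
    keeps the list independent of \<open>ks\<close> and y.\<close>
  then obtain N where N: "N > 0" "little_o (\<lambda>t. ?x t ^ N)"
    using Ro_nilpotent[OF x] by (auto simp: st_def)
  let ?w = "\<lambda>k. abs_fermat (\<lambda>t. ?x t ^ k / fact k)"
  have wRo: "(\<lambda>t. ?x t ^ k / fact k) \<in> Ro" for k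
    unfolding divide_inverse by (intro Ro_mult Ro_power x Ro_const)
  define F where "F k = map (\<lambda>(w, l). (?w k * w, l @ replicate k j)) L" for k
  have F: "taylor_sum D pd ?c (F k) ks y = ?w k * taylor_sum D pd ?c L (replicate k j @ ks) y" for k ks y
    by (simp add: taylor_sum_def F_def sum_list_const_mult[symmetric] o_def case_prod_unfold mult.assoc)
  have "(\<lambda>t. D ks (frozen pd p y j t)) \<in> Ro \<and>
      abs_fermat (\<lambda>t. D ks (frozen pd p y j t)) = taylor_sum D pd ?c (concat (map F [0..<N])) ks y"
    if ks: "set ks \<subseteq> {..pd}" and y: "st y \<in> V" for ks y
  proof -
    let ?g = "\<lambda>k t. ?x t ^ k / fact k * D (replicate k j @ ks) (frozen pd p y (Suc j) t)"
    have jks: "set (replicate k j @ ks) \<subseteq> {..pd}" for k using ks step.hyps by auto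
    have "?c(pd := st y) \<in> prodPV pd P V"
    proof -
      have "?c pd = 0" by (simp add: stp_def)
      then have "?c(pd := 0) = ?c" by (metis fun_upd_triv)
      then show ?thesis using P(2) y by (auto simp: prodPV_def Rd_def stp_def)
    qed
    from frozen_step_taylor[OF D openin_prodPV[OF P(1) V] this ks _ N] step.hyps
    have lo: "little_o (\<lambda>t. D ks (frozen pd p y j t) - (\<Sum>k<N. ?g k t))" by simp
    have gRo: "?g k \<in> Ro" for k by (intro Ro_mult wRo L(2) jks y)
    then have "(\<lambda>t. \<Sum>k<N. ?g k t) \<in> Ro" by (intro Ro_sum)
    with lo have "(\<lambda>t. D ks (frozen pd p y j t)) \<in> Ro"
      "abs_fermat (\<lambda>t. D ks (frozen pd p y j t)) = abs_fermat (\<lambda>t. \<Sum>k<N. ?g k t)"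
      by (auto intro: Ro_cong_little_o abs_fermat_eqI)
    moreover have "abs_fermat (\<lambda>t. \<Sum>k<N. ?g k t) = (\<Sum>k<N. abs_fermat (?g k))"
      by (rule abs_fermat_sum[symmetric]) (rule gRo)
    moreover have "abs_fermat (?g k) = taylor_sum D pd ?c (F k) ks y" for k
      unfolding F L(3)[OF jks y, symmetric] abs_fermat_times[OF wRo L(2)[OF jks y]] ..
    moreover have "(\<Sum>k<N. taylor_sum D pd ?c (F k) ks y) = taylor_sum D pd ?c (concat (map F [0..<N])) ks y"
      unfolding taylor_sum_def sum_list_concat_upt ..
    ultimately show ?thesis by simp
  qed
  moreover have "\<forall>(w, l)\<in>set (concat (map F [0..<N])). set l \<subseteq> {..<pd}"
    using L(1) step.hyps by (force simp: F_def)
  ultimately show ?case by (intro exI[of _ "concat (map F [0..<N])"]) auto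
qed

section \<open>Local representations and linear combinations\<close>

lemma smooth_Rd_partials:
  "smooth_Rd d U g \<longleftrightarrow> (\<exists>D. (\<forall>z\<in>U. D [] z = g z) \<and> partials d U D)"
  by (simp add: smooth_Rd_def partials_def)

lemma flift_frozen: "flift pd \<alpha> p y = abs_fermat (\<lambda>t. \<alpha> (frozen pd p y 0 t))"
  by (simp add: flift_def frozen_def)

text \<open>The expansions of \<alpha> and of its x-derivative share their coefficients, so after
  exchanging partial derivatives the second is the termwise derivative of the first.\<close>

lemma local_rep_imp_comb:
  assumes "local_rep S g x pd P V p \<alpha>"
  obtains ws where "deriv_chains ws V"
    "\<And>y. st y \<in> V \<Longrightarrow> flift pd \<alpha> p y = comb ws 0 y"
    "\<And>y. st y \<in> V \<Longrightarrow> flift pd (pderiv_at pd \<alpha>) p y = comb ws 1 y"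
proof -
  let ?U = "prodPV pd P V" and ?c = "stp pd p"
  have V: "open V" and P: "open_Rd pd P" "?c \<in> P" "P \<subseteq> Rd pd"
    using assms by (auto simp: local_rep_def open_Rd_def)
  obtain D where D: "\<forall>z\<in>?U. D [] z = \<alpha> z" "partials (Suc pd) ?U D"
    using assms by (auto simp: local_rep_def smooth_Rd_partials)
  have U: "openin (top_of_set (Rd (Suc pd))) ?U" using P V by (intro openin_prodPV)
  obtain L where L: "\<forall>(w, l)\<in>set L. set l \<subseteq> {..<pd}"
    "\<And>ks y. set ks \<subseteq> {..pd} \<Longrightarrow> st y \<in> V \<Longrightarrow> (\<lambda>t. D ks (frozen pd p y 0 t)) \<in> Ro"
    "\<And>ks y. set ks \<subseteq> {..pd} \<Longrightarrow> st y \<in> V \<Longrightarrow>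
      abs_fermat (\<lambda>t. D ks (frozen pd p y 0 t)) = taylor_sum D pd ?c L ks y"
    using frozen_expansion[OF D(2) P(1,2) V, of 0] by blast
  define ws where "ws = map (\<lambda>(w, l). (w, \<lambda>k s. D (replicate k pd @ l) (?c(pd := s)))) L"
  have slice: "deriv_chain (\<lambda>k s. D (replicate k pd @ l) (?c(pd := s))) V" if "set l \<subseteq> {..pd}" for l
    using deriv_chain_slice[OF D(2) P(2,3) that] .
  have upd: "?c(pd := s) \<in> ?U" if "s \<in> V" for s
  proof -
    have "?c(pd := 0) = ?c" by (auto simp: stp_def)
    then show ?thesis using P(2) that by (auto simp: prodPV_def Rd_def stp_def)
  qed
  have chains: "deriv_chains ws V"
    unfolding ws_def deriv_chains_def using L(1) by (force intro!: slice)
  have comb_ws: "comb ws k y = (\<Sum>(w, l)\<leftarrow>L. w * fapp (\<lambda>s. D (replicate k pd @ l) (?c(pd := s))) y)" for k y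
    by (simp add: ws_def comb_def o_def case_prod_unfold)
  have in_U: "\<forall>\<^sub>F t in at_right 0. frozen pd p y 0 t \<in> ?U" "frozen pd p y 0 0 \<in> ?U" if y: "st y \<in> V" for y
  proof -
    show "frozen pd p y 0 0 \<in> ?U" using upd[OF y] by (simp add: frozen_zero)
    obtain \<delta> where \<delta>: "\<delta> > 0" "\<forall>z\<in>Rd (Suc pd). (\<forall>i<Suc pd. \<bar>z i - (?c(pd := st y)) i\<bar> < \<delta>) \<longrightarrow> z \<in> ?U"
      using openin_Rd_box[OF U upd[OF y]] by blast
    show "\<forall>\<^sub>F t in at_right 0. frozen pd p y 0 t \<in> ?U"
      using eventually_frozen_near[OF le0 \<delta>(1)]
      by (rule eventually_mono) (intro \<delta>(2)[rule_format] frozen_Rd le0, blast)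
  qed
  have lift: "flift pd \<beta> p y = taylor_sum D pd ?c L ks y"
    if "\<And>z. z \<in> ?U \<Longrightarrow> \<beta> z = D ks z" "set ks \<subseteq> {..pd}" "st y \<in> V" for \<beta> ks y
    unfolding flift_frozen L(3)[OF that(2,3), symmetric]
  proof (rule abs_fermat_eqI[OF L(2)[OF that(2,3)]], rule little_o_eventually_eq)
    show "\<forall>\<^sub>F t in at_right 0. \<beta> (frozen pd p y 0 t) = D ks (frozen pd p y 0 t)"
      using in_U(1)[OF that(3)] by eventually_elim (rule that(1))
  qed (rule that(1)[OF in_U(2)[OF that(3)]])
  have "flift pd \<alpha> p y = comb ws 0 y" if "st y \<in> V" for y
    using lift[of \<alpha> "[]" y] D(1) that by (simp add: comb_ws taylor_sum_def)
  moreover have "flift pd (pderiv_at pd \<alpha>) p y = comb ws 1 y" if y: "st y \<in> V" for y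
  proof -
    have "pderiv_at pd \<alpha> z = D [pd] z" if z: "z \<in> ?U" for z
    proof -
      have "((\<lambda>s. D [] (z(pd := s))) has_real_derivative D [pd] (z(pd := z pd))) (at (z pd))"
        using z by (intro partials_deriv[OF D(2)]) auto
      then have "((\<lambda>s. D [] (z(pd := s))) has_real_derivative D [pd] z) (at (z pd))"
        by simp
      then have "((\<lambda>s. \<alpha> (z(pd := s))) has_real_derivative D [pd] z) (at (z pd))"
      proof (rule has_field_derivative_transform_within_open[OF _ V])
        show "z pd \<in> V" using z by (simp add: prodPV_def)
        show "D [] (z(pd := s)) = \<alpha> (z(pd := s))" if "s \<in> V" for s
          using z that by (intro D(1)[rule_format]) (auto simp: prodPV_def Rd_def)
      qed
      then show ?thesis unfolding pderiv_at_def by (rule DERIV_imp_deriv)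
    qed
    then have "flift pd (pderiv_at pd \<alpha>) p y = taylor_sum D pd ?c L [pd] y"
      using y by (intro lift) auto
    also have "\<dots> = comb ws 1 y"
      unfolding taylor_sum_def comb_ws
    proof (intro arg_cong[of _ _ sum_list] map_cong refl, clarify)
      fix w l assume wl: "(w, l) \<in> set L"
      then have l: "set l \<subseteq> {..<pd}" using L(1) by auto
      have "fapp (\<lambda>s. D (l @ [pd]) (?c(pd := s))) y = fapp (\<lambda>s. D (replicate 1 pd @ l) (?c(pd := s))) y"
      proof (rule fapp_cong[OF V y])
        show "D (l @ [pd]) (?c(pd := s)) = D (replicate 1 pd @ l) (?c(pd := s))" if "s \<in> V" for s
          using partials_rotate[OF D(2) U _ _ upd[OF that], of l pd] subset_trans[OF l] by simp
        show "(\<lambda>t. D (replicate 1 pd @ l) (?c(pd := rep_fermat y t))) \<in> Ro"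
          using l by (intro fapp_Ro[OF slice V y]) auto
      qed
      then show "w * fapp (\<lambda>s. D (l @ [pd]) (?c(pd := s))) y
          = w * fapp (\<lambda>s. D (replicate 1 pd @ l) (?c(pd := s))) y" by simp
    qed
    finally show ?thesis .
  qed
  ultimately show ?thesis using that chains by blast
qed

text \<open>A combination is affine in its coefficients, which serve as the parameters: after one
  derivative with respect to a parameter, any further one vanishes.\<close>

lemma smooth_Rd_linear_combination:
  assumes "\<And>i. i < M \<Longrightarrow> deriv_chain (E i) V"
  shows "smooth_Rd (Suc M) (prodPV M P V) (\<lambda>z. \<Sum>i<M. z i * E i 0 (z M))"
proof -
  \<comment> \<open>The variable has index M, so k counts the derivatives in it; the filtered list
    holds the parameter directions.\<close>
  define D where "D ks z = (let k = count_list ks M in case filter (\<lambda>i. i \<noteq> M) ks of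
      [] \<Rightarrow> (\<Sum>i<M. z i * E i k (z M)) | [i] \<Rightarrow> E i k (z M) | _ \<Rightarrow> 0)"
    for ks and z :: "nat \<Rightarrow> real"
  have coord: "continuous_on (prodPV M P V) (\<lambda>z. z i)" for i :: nat
    by (rule continuous_on_subset[OF continuous_on_product_coordinates]) simp
  have cont: "continuous_on (prodPV M P V) (\<lambda>z. E i k (z M))" if "i < M" for i k
  proof (rule continuous_on_compose2[of V "E i k"])
    show "continuous_on V (E i k)"
      using deriv_chain_isCont[OF assms[OF that]] by (intro continuous_at_imp_continuous_on) auto
    show "continuous_on (prodPV M P V) (\<lambda>z. z M)"
      by (rule coord)
  qed (auto simp: prodPV_def)
  have "partials (Suc M) (prodPV M P V) D"
    unfolding partials_def
  proof (intro allI impI conjI ballI)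
    fix ks assume ks: "set ks \<subseteq> {..<Suc M}"
    consider "filter (\<lambda>i. i \<noteq> M) ks = []" | m where "filter (\<lambda>i. i \<noteq> M) ks = [m]" "m < M"
      | m m' ms where "filter (\<lambda>i. i \<noteq> M) ks = m # m' # ms"
    proof (cases "filter (\<lambda>i. i \<noteq> M) ks")
      case (Cons m ms)
      then have "m \<in> set (filter (\<lambda>i. i \<noteq> M) ks)" by simp
      with ks have "m < M" by force
      with Cons that show ?thesis by (cases ms) auto
    qed (use that in auto)
    note shape = this
    show "continuous_on (prodPV M P V) (D ks)"
      by (rule shape) (auto simp: D_def intro!: continuous_intros cont coord)
    fix i z assume i: "i < Suc M" and z: "z \<in> prodPV M P V"
    have E: "(E m k has_real_derivative E m (Suc k) (z M)) (at (z M))" if "m < M" for m k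
      using z by (intro deriv_chainD[OF assms[OF that]]) (simp add: prodPV_def)
    show "((\<lambda>s. D ks (z(i := s))) has_real_derivative D (i # ks) z) (at (z i))"
    proof (cases "i = M")
      case True
      show ?thesis
        by (rule shape)
          (auto simp: D_def True mult.commute intro!: derivative_eq_intros E sum.cong)
    next
      case False
      with i have "i < M" by simp
      let ?k = "count_list ks M"
      have "((\<lambda>s. \<Sum>m<M. (z(i := s)) m * E m ?k (z M)) has_real_derivative
          (\<Sum>m<M. if m = i then E i ?k (z M) else 0)) (at (z i))"
        by (intro DERIV_sum) (auto intro!: derivative_eq_intros)
      then have "((\<lambda>s. \<Sum>m<M. (z(i := s)) m * E m ?k (z M)) has_real_derivative E i ?k (z M)) (at (z i))"
        using \<open>i < M\<close> by (simp add: sum.delta)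
      with False show ?thesis
        by (rule_tac shape) (auto simp: D_def)
    qed
  qed
  moreover have "D [] z = (\<Sum>i<M. z i * E i 0 (z M))" for z by (simp add: D_def)
  ultimately show ?thesis unfolding smooth_Rd_partials by blast
qed

text \<open>Converse of \<open>local_rep_imp_comb\<close>. A function linear in its parameters puts
  no restriction on them, so the parameter domain can be all of \<open>Rd M\<close>.\<close>

lemma comb_imp_local_rep:
  assumes ws: "deriv_chains ws V" and V: "open V" "st x \<in> V"
    and F: "\<And>y. y \<in> S \<Longrightarrow> st y \<in> V \<Longrightarrow> F y = comb ws 0 y"
  shows "\<exists>pd P V p \<alpha>. local_rep S F x pd P V p \<alpha>"
proof -
  define M where "M = length ws"
  define p where "p i = fst (ws ! i)" for i
  define E where "E i = snd (ws ! i)" for i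
  define \<alpha> where "\<alpha> z = (\<Sum>i<M. z i * E i 0 (z M))" for z :: "nat \<Rightarrow> real"
  have E: "deriv_chain (E i) V" if "i < M" for i
    using ws that nth_mem[of i ws] by (auto simp: deriv_chains_def M_def E_def case_prod_unfold)
  have "F y = flift M \<alpha> p y" if y: "y \<in> S" "st y \<in> V" for y
  proof -
    have "F y = (\<Sum>i<M. p i * fapp (E i 0) y)"
      unfolding F[OF y] comb_def
      by (simp add: sum_list_sum_nth atLeast0LessThan M_def p_def E_def case_prod_unfold)
    also have "\<dots> = (\<Sum>i<M. abs_fermat (\<lambda>t. rep_fermat (p i) t * E i 0 (rep_fermat y t)))"
      using abs_fermat_times[OF rep_fermat_Ro fapp_Ro[OF E V(1) y(2)]]
      by (intro sum.cong) (auto simp: fapp_def abs_rep_fermat)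
    also have "\<dots> = abs_fermat (\<lambda>t. \<Sum>i<M. rep_fermat (p i) t * E i 0 (rep_fermat y t))"
      by (intro abs_fermat_sum Ro_mult rep_fermat_Ro fapp_Ro[OF E V(1) y(2)]) auto
    also have "\<dots> = flift M \<alpha> p y"
      by (simp add: flift_def \<alpha>_def)
    finally show ?thesis .
  qed
  moreover have "smooth_Rd (Suc M) (prodPV M (Rd M) V) \<alpha>"
    unfolding \<alpha>_def using E by (rule smooth_Rd_linear_combination)
  ultimately have "local_rep S F x M (Rd M) V p \<alpha>"
    using V by (auto simp: local_rep_def open_Rd_def stp_def Rd_def)
  then show ?thesis by blast
qed

section \<open>Primitives on a non-infinitesimal interval\<close>

text \<open>What the calculus needs to know about J. A point of J over an end of the real interval
  may see only part of the Fermat reals infinitely close to it, yet the standard points over A still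
  approach its standard part.\<close>

locale fermat_interval =
  fixes J :: "fermat set" and A :: "real set"
  assumes open_core: "open A"
    and interval_core: "is_interval A"
    and core: "r \<in> A \<Longrightarrow> fconst r \<in> J"
    and closure_core: "x \<in> J \<Longrightarrow> st x \<in> closure A"
    and interval_st: "is_interval (st ` J)"

lemma noninf_fint_imp_fermat_interval:
  assumes "noninf_fint J"
  obtains A where "fermat_interval J A"
proof -
  obtain a b where J: "fint_with J a b" and ab: "fext_st a < fext_st b"
    using assms unfolding noninf_fint_def by blast
  define A where "A = {r. fext_st a < ereal r \<and> ereal r < fext_st b}"
  have st_le: "fext_st a \<le> ereal (st x) \<and> ereal (st x) \<le> fext_st b" if "x \<in> J" for x
  proof -
    have "fext_le a (Fin x)" "fext_le (Fin x) b"
      using that J by (auto simp: fint_with_def fext_lt_def)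
    then show ?thesis by (cases a; cases b) (auto dest: st_mono)
  qed
  have lt: "fext_lt a (Fin x)" if "fext_st a < ereal (st x)" for x
    using that less_if_st_less[of _ x] by (cases a) (auto simp: fext_lt_def intro: less_imp_le)
  have gt: "fext_lt (Fin x) b" if "ereal (st x) < fext_st b" for x
    using that less_if_st_less[of x] by (cases b) (auto simp: fext_lt_def intro: less_imp_le)
  \<comment> \<open>Strict inequality of standard parts implies strict inequality in the order, so
    the four kinds of interval need not be told apart here.\<close>
  have in_J: "x \<in> J" if "st x \<in> A" for x
    using lt[of x] gt[of x] that J by (auto simp: A_def fint_with_def fext_lt_def)
  have between_in_A: "s \<in> A" if "fext_st a \<le> ereal p" "p < s" "s < q" "ereal q \<le> fext_st b" for p q s
    using that le_less_trans[of "fext_st a" "ereal p" "ereal s"]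
      less_le_trans[of "ereal s" "ereal q" "fext_st b"] by (simp add: A_def)
  \<comment> \<open>Non-infinitesimality enters here. The open segment between r and any other
    \<open>st x\<close> lies in A and has \<open>st x\<close> in its closure.\<close>
  obtain r where r: "r \<in> A"
    using ereal_dense2[OF ab] by (auto simp: A_def)
  have "fermat_interval J A"
  proof
    show "open A"
      using open_Collect_conj[OF open_Collect_less open_Collect_less, of "\<lambda>_. fext_st a" ereal ereal "\<lambda>_. fext_st b"]
      by (simp add: A_def continuous_on_ereal)
    show "is_interval A"
      unfolding is_interval_1 A_def
      by (auto intro: less_le_trans[of _ "ereal _"] le_less_trans[of "ereal _" "ereal _"])
    show "fconst r \<in> J" if "r \<in> A" for r using in_J[of "fconst r"] that by simp
    show "st x \<in> closure A" if x: "x \<in> J" for x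
    proof -
      consider "st x < r" | "st x = r" | "r < st x" by linarith
      then show ?thesis
      proof cases
        case 1
        then have "{st x<..<r} \<subseteq> A"
          using between_in_A[of "st x" _ r] st_le[OF x] r by (auto simp: A_def)
        then have "closure {st x<..<r} \<subseteq> closure A" by (rule closure_mono)
        then show ?thesis using 1 by auto
      next
        case 2
        then show ?thesis using r closure_subset by auto
      next
        case 3
        then have "{r<..<st x} \<subseteq> A"
          using between_in_A[of r _ "st x"] st_le[OF x] r by (auto simp: A_def)
        then have "closure {r<..<st x} \<subseteq> closure A" by (rule closure_mono)
        then show ?thesis using 3 by auto
      qed
    qed
    show "is_interval (st ` J)"
      unfolding is_interval_1
    proof (intro ballI allI impI)
      fix p q s assume "p \<in> st ` J" "q \<in> st ` J" "p \<le> s \<and> s \<le> q"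
      then consider "s \<in> st ` J" | "p < s" "s < q" by fastforce
      then show "s \<in> st ` J"
      proof cases
        case 2
        then have "s \<in> A"
          using \<open>p \<in> st ` J\<close> \<open>q \<in> st ` J\<close> st_le between_in_A[of p s q] by auto
        then have "fconst s \<in> J" using in_J[of "fconst s"] by simp
        then show ?thesis by (metis image_eqI st_fconst)
      qed
    qed
  qed
  then show ?thesis by (rule that)
qed

text \<open>An antiderivative is put in front of the chain. It is found on a closed interval, and
  its derivative becomes two-sided only inside; hence \<open>cball\<close> in the hypothesis and
  \<open>ball\<close> in the conclusion.\<close>

lemma deriv_chain_antiderivative:
  assumes D: "deriv_chain D V" and d: "cball x d \<subseteq> V"
  obtains G where "deriv_chain G (ball x d)" "\<And>n. G (Suc n) = D n"
proof -
  have "continuous_on {x - d..x + d} (D 0)"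
    using d deriv_chain_isCont[OF D] by (intro continuous_at_imp_continuous_on) (auto simp: cball_eq_atLeastAtMost)
  then obtain g where g: "\<And>s. s \<in> {x - d..x + d} \<Longrightarrow>
      (g has_vector_derivative D 0 s) (at s within {x - d..x + d})"
    using antiderivative_continuous by blast
  define G where "G n = (case n of 0 \<Rightarrow> g | Suc m \<Rightarrow> D m)" for n
  have "(G n has_real_derivative G (Suc n) s) (at s)" if s: "s \<in> ball x d" for n s
  proof (cases n)
    case 0
    have s': "s \<in> {x - d<..<x + d}" using s by (auto simp: ball_eq_greaterThanLessThan)
    then have "at s within {x - d..x + d} = at s" by (intro at_within_interior) simp
    with g[of s] s' show ?thesis
      by (auto simp: G_def 0 has_real_derivative_iff_has_vector_derivative)
  next
    case (Suc m)
    have "s \<in> V" using s d ball_subset_cball by blast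
    then show ?thesis using deriv_chainD[OF D] by (simp add: G_def Suc)
  qed
  then show ?thesis using that[of G] by (simp add: deriv_chain_def G_def)
qed

lemma comb_antiderivative:
  assumes "deriv_chains ws V" and d: "cball x d \<subseteq> V"
  shows "\<exists>vs. deriv_chains vs (ball x d) \<and> (\<forall>k y. comb vs (Suc k) y = comb ws k y)"
  using assms(1)
proof (induction ws)
  case (Cons wD ws)
  obtain w D where wD: "wD = (w, D)" by force
  obtain vs where vs: "deriv_chains vs (ball x d)" "\<forall>k y. comb vs (Suc k) y = comb ws k y"
    using Cons by (auto simp: wD)
  obtain G where "deriv_chain G (ball x d)" "\<And>n. G (Suc n) = D n"
    using deriv_chain_antiderivative[OF _ d, of D] Cons.prems by (auto simp: wD)
  with vs show ?case by (intro exI[of _ "(w, G) # vs"]) (simp add: wD)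
qed (auto intro: exI[of _ "[]"])

context fermat_interval
begin

text \<open>The choice in \<open>fderiv_on\<close> is harmless: any representation yields a
  combination whose difference from \<open>ws\<close> vanishes at the standard points over V
  \<inter> W \<inter> A, and \<open>st x\<close> is in the closure of that set.\<close>

lemma fderiv_on_comb:
  assumes x: "x \<in> J" "st x \<in> W" and W: "open W" and ws: "deriv_chains ws W"
    and g: "\<And>y. y \<in> J \<Longrightarrow> st y \<in> W \<Longrightarrow> g y = comb ws 0 y"
  shows "fderiv_on J g x = comb ws 1 x"
proof -
  have unique: "flift pd (pderiv_at pd \<alpha>) p x = comb ws 1 x" if rep: "local_rep J g x pd P V p \<alpha>"
    for pd P V p \<alpha>
  proof -
    obtain vs where vs: "deriv_chains vs V"
      "\<And>y. st y \<in> V \<Longrightarrow> flift pd \<alpha> p y = comb vs 0 y"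
      "\<And>y. st y \<in> V \<Longrightarrow> flift pd (pderiv_at pd \<alpha>) p y = comb vs 1 y"
      using local_rep_imp_comb[OF rep] by blast
    have V: "open V" "st x \<in> V" "\<And>y. y \<in> J \<Longrightarrow> st y \<in> V \<Longrightarrow> g y = comb vs 0 y"
      using rep vs(2) by (auto simp: local_rep_def)
    let ?us = "vs @ map (\<lambda>(w, D). (- w, D)) ws"
    have cl: "st x \<in> closure ((V \<inter> W) \<inter> A)"
      using open_Int_closure_subset[of "V \<inter> W" A] V(1,2) W x closure_core by auto
    have zero: "comb ?us 0 (fconst r) = 0" if "r \<in> (V \<inter> W) \<inter> A" for r
      using that V(3)[of "fconst r"] g[of "fconst r"] core by (simp add: comb_uminus)
    have chains: "deriv_chains ?us (V \<inter> W)"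
      using vs(1) ws by (auto simp: deriv_chains_uminus intro: deriv_chains_subset)
    have "comb ?us 1 x = 0"
      by (rule comb_zero_imp_deriv_zero[OF chains open_Int[OF V(1) W]
            open_Int[OF open_Int[OF V(1) W] open_core] Int_lower1 zero _ cl])
        (simp_all add: V(2) x(2))
    then show ?thesis using vs(3)[OF V(2)] by (simp add: comb_uminus)
  qed
  \<comment> \<open>The choice operator also needs a witness, obtained by turning \<open>ws\<close>
    back into a representation.\<close>
  have "\<exists>d pd P V p \<alpha>. local_rep J g x pd P V p \<alpha> \<and> d = flift pd (pderiv_at pd \<alpha>) p x"
    using comb_imp_local_rep[OF ws W x(2), of J g] g by blast
  then have "\<exists>pd P V p \<alpha>. local_rep J g x pd P V p \<alpha> \<and> fderiv_on J g x = flift pd (pderiv_at pd \<alpha>) p x"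
    unfolding fderiv_on_def by (rule someI_ex)
  then show ?thesis using unique by auto
qed

text \<open>Attached to a real number c and not to a point of J, so that primitives can be
  restricted and glued over subsets of the real line.\<close>

definition local_primitive :: "(fermat \<Rightarrow> fermat) \<Rightarrow> (fermat \<Rightarrow> fermat) \<Rightarrow> real \<Rightarrow> bool" where
  "local_primitive f F c \<longleftrightarrow> (\<exists>V ws. open V \<and> c \<in> V \<and> deriv_chains ws V \<and>
    (\<forall>y\<in>J. st y \<in> V \<longrightarrow> F y = comb ws 0 y \<and> f y = comb ws 1 y))"

text \<open>A combination representing F near x also computes \<open>fderiv_on\<close> at all
  neighbouring points of J, not just at x. This replaces a pointwise choice by a local
  condition.\<close>

lemma local_primitive_iff:
  "(\<forall>x\<in>J. local_primitive f F (st x)) \<longleftrightarrow> fsmooth_on J F \<and> (\<forall>x\<in>J. fderiv_on J F x = f x)"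
proof (intro iffI conjI ballI)
  assume prim: "\<forall>x\<in>J. local_primitive f F (st x)"
  show "fsmooth_on J F"
    unfolding fsmooth_on_def
  proof
    fix x assume "x \<in> J"
    with prim obtain V ws where "open V" "st x \<in> V" "deriv_chains ws V"
      "\<forall>y\<in>J. st y \<in> V \<longrightarrow> F y = comb ws 0 y"
      unfolding local_primitive_def by meson
    then show "\<exists>pd P V p \<alpha>. local_rep J F x pd P V p \<alpha>"
      by (intro comb_imp_local_rep) auto
  qed
  show "fderiv_on J F x = f x" if x: "x \<in> J" for x
  proof -
    from prim x obtain V ws where V: "open V" "st x \<in> V" "deriv_chains ws V"
      "\<forall>y\<in>J. st y \<in> V \<longrightarrow> F y = comb ws 0 y \<and> f y = comb ws 1 y"
      unfolding local_primitive_def by meson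
    then have "fderiv_on J F x = comb ws 1 x"
      using x by (intro fderiv_on_comb) auto
    then show ?thesis using V x by simp
  qed
next
  fix x assume F: "fsmooth_on J F \<and> (\<forall>x\<in>J. fderiv_on J F x = f x)" and x: "x \<in> J"
  then obtain pd P V p \<alpha> where rep: "local_rep J F x pd P V p \<alpha>"
    unfolding fsmooth_on_def by blast
  obtain ws where ws: "deriv_chains ws V" "\<And>y. st y \<in> V \<Longrightarrow> flift pd \<alpha> p y = comb ws 0 y"
    "\<And>y. st y \<in> V \<Longrightarrow> flift pd (pderiv_at pd \<alpha>) p y = comb ws 1 y"
    using local_rep_imp_comb[OF rep] by blast
  have V: "open V" "st x \<in> V" "\<And>y. y \<in> J \<Longrightarrow> st y \<in> V \<Longrightarrow> F y = comb ws 0 y"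
    using rep ws(2) by (auto simp: local_rep_def)
  have "f y = comb ws 1 y" if "y \<in> J" "st y \<in> V" for y
    using fderiv_on_comb[OF that V(1) ws(1) V(3)] F that(1) by simp
  then show "local_primitive f F (st x)"
    unfolding local_primitive_def using V ws(1) by blast
qed

lemma local_primitive_cong:
  assumes "local_primitive f F c" "open W" "c \<in> W" "\<And>y. y \<in> J \<Longrightarrow> st y \<in> W \<Longrightarrow> G y = F y"
  shows "local_primitive f G c"
proof -
  obtain V ws where "open V" "c \<in> V" "deriv_chains ws V"
    "\<forall>y\<in>J. st y \<in> V \<longrightarrow> F y = comb ws 0 y \<and> f y = comb ws 1 y"
    using assms(1) unfolding local_primitive_def by blast
  then show ?thesis
    unfolding local_primitive_def using assms(2-4)
    by (intro exI[of _ "V \<inter> W"] exI[of _ ws]) (auto intro: deriv_chains_subset)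
qed

lemma local_primitive_add_const:
  assumes "local_primitive f F c"
  shows "local_primitive f (\<lambda>y. F y + k) c"
proof -
  obtain V ws where V: "open V" "c \<in> V" "deriv_chains ws V"
    "\<forall>y\<in>J. st y \<in> V \<longrightarrow> F y = comb ws 0 y \<and> f y = comb ws 1 y"
    using assms unfolding local_primitive_def by blast
  let ?D = "\<lambda>n s. if n = 0 then 1 else 0 :: real"
  have "deriv_chain ?D V" by (simp add: deriv_chain_def)
  with V show ?thesis
    unfolding local_primitive_def
    by (intro exI[of _ V] exI[of _ "(k, ?D) # ws"])
       (simp add: fapp_def one_fermat_def[symmetric] zero_fermat_def[symmetric] add.commute)
qed

lemma local_primitive_open:
  assumes "local_primitive f F c"
  shows "\<exists>e>0. \<forall>q\<in>ball c e. local_primitive f F q"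
  using assms unfolding local_primitive_def open_contains_ball by (meson subsetD)

text \<open>Both derivatives equal f, so the difference of the two combinations has derivative 0 at
  standard points. Passing to a ball makes the intersection with A an interval and hence
  connected.\<close>

lemma local_primitive_unique:
  assumes "local_primitive f F c" "local_primitive f G c"
  shows "\<exists>W k. open W \<and> c \<in> W \<and> (\<forall>y\<in>J. st y \<in> W \<longrightarrow> F y = G y + k)"
proof -
  obtain V ws where V: "open V" "c \<in> V" "deriv_chains ws V"
    "\<forall>y\<in>J. st y \<in> V \<longrightarrow> F y = comb ws 0 y \<and> f y = comb ws 1 y"
    using assms(1) unfolding local_primitive_def by blast
  obtain V' vs where V': "open V'" "c \<in> V'" "deriv_chains vs V'"
    "\<forall>y\<in>J. st y \<in> V' \<longrightarrow> G y = comb vs 0 y \<and> f y = comb vs 1 y"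
    using assms(2) unfolding local_primitive_def by blast
  obtain e where e: "e > 0" "ball c e \<subseteq> V \<inter> V'"
    using open_contains_ball[THEN iffD1, OF open_Int[OF V(1) V'(1)]] V(2) V'(2) by blast
  let ?us = "ws @ map (\<lambda>(w, D). (- w, D)) vs"
  have chains: "deriv_chains ?us (ball c e)"
    using V(3) V'(3) e(2) by (auto simp: deriv_chains_uminus intro: deriv_chains_subset)
  have conn: "connected (ball c e \<inter> A)"
    using interval_core by (intro is_interval_connected is_interval_Int)
      (auto simp: is_interval_ball_real)
  have zero: "comb ?us 1 (fconst r) = 0" if "r \<in> ball c e \<inter> A" for r
  proof -
    have "fconst r \<in> J" "st (fconst r) \<in> V" "st (fconst r) \<in> V'" using that core e(2) by auto
    then show ?thesis using V(4) V'(4) by (auto simp: comb_uminus)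
  qed
  have "\<exists>k. \<forall>y. st y \<in> ball c e \<and> st y \<in> closure (ball c e \<inter> A) \<longrightarrow> comb ?us 0 y = k"
    by (rule comb_deriv_zero_imp_const[OF chains open_ball open_Int[OF open_ball open_core]
          Int_lower1 conn zero])
  then obtain k where k: "\<And>y. st y \<in> ball c e \<Longrightarrow> st y \<in> closure (ball c e \<inter> A) \<Longrightarrow> comb ?us 0 y = k"
    by blast
  have "F y = G y + k" if y: "y \<in> J" "st y \<in> ball c e" for y
  proof -
    have "st y \<in> closure (ball c e \<inter> A)"
      using open_Int_closure_subset[of "ball c e" A] y closure_core by auto
    from k[OF y(2) this] have "comb ws 0 y = comb vs 0 y + k"
      by (simp add: comb_uminus algebra_simps)
    moreover have "st y \<in> V" "st y \<in> V'" using y(2) e(2) by blast+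
    ultimately show ?thesis using V(4) V'(4) y(1) by simp
  qed
  then show ?thesis using e(1) by (intro exI[of _ "ball c e"] exI[of _ k]) auto
qed

text \<open>Equality of F - G over two standard parts is a locally trivial relation, hence holds
  throughout a connected set. The relation ranges over all points above a real, so infinitely close
  points are covered too.\<close>

lemma primitive_unique:
  assumes S: "connected S" "S \<subseteq> st ` J"
    and FG: "\<And>c. c \<in> S \<Longrightarrow> local_primitive f F c" "\<And>c. c \<in> S \<Longrightarrow> local_primitive f G c"
    and uv: "u \<in> J" "v \<in> J" "st u \<in> S" "st v \<in> S"
  shows "F u - G u = F v - G v"
proof -
  let ?R = "\<lambda>a b. \<forall>x\<in>J. \<forall>y\<in>J. st x = a \<longrightarrow> st y = b \<longrightarrow> F x - G x = F y - G y"
  have "?R (st u) (st v)"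
  proof (rule connected_equivalence_relation[OF S(1) uv(3,4)])
    show "?R b a" if "?R a b" for a b using that by metis
    \<comment> \<open>Transitivity needs an actual point of J above b; without one the relation
      would hold vacuously.\<close>
    show "?R a c" if R: "?R a b" "?R b c" and b: "b \<in> S" for a b c
    proof -
      obtain z where "z \<in> J" "st z = b" using b S(2) by auto
      then show ?thesis using R by metis
    qed
    fix a assume a: "a \<in> S"
    obtain W k where W: "open W" "a \<in> W" "\<forall>y\<in>J. st y \<in> W \<longrightarrow> F y = G y + k"
      using local_primitive_unique[OF FG(1)[OF a] FG(2)[OF a]] by blast
    then show "\<exists>T. openin (top_of_set S) T \<and> a \<in> T \<and> (\<forall>x\<in>T. ?R a x)"
      using a by (intro exI[of _ "S \<inter> W"]) (auto simp: openin_open_Int)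
  qed
  then show ?thesis using uv by blast
qed

text \<open>Near b the primitives differ by a constant. Once G is shifted by it, both branches agree
  over a neighbourhood of b and the cut at b does no harm.\<close>

lemma local_primitive_glue:
  assumes F: "\<forall>q\<in>{a..b}. local_primitive f F q" and G: "\<forall>q\<in>{b..c}. local_primitive f G q"
    and "a \<le> b" "b \<le> c"
  shows "\<exists>H. \<forall>q\<in>{a..c}. local_primitive f H q"
proof -
  obtain W k where W: "open W" "b \<in> W" "\<forall>y\<in>J. st y \<in> W \<longrightarrow> F y = G y + k"
    using local_primitive_unique[of f F b G] F G assms(3,4) by auto
  define H where "H y = (if st y \<le> b then F y else G y + k)" for y
  have "local_primitive f H q" if q: "q \<in> {a..c}" for q
  proof -
    consider "q < b" | "q = b" | "b < q" by linarith
    then show ?thesis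
    proof cases
      case 1
      with q F have "local_primitive f F q" by auto
      then show ?thesis
        by (rule local_primitive_cong[where W = "{..<b}"]) (use 1 in \<open>auto simp: H_def\<close>)
    next
      case 2
      with q F assms(3) have "local_primitive f F q" by auto
      then show ?thesis
        by (rule local_primitive_cong[where W = W]) (use 2 W in \<open>auto simp: H_def\<close>)
    next
      case 3
      with q G have "local_primitive f (\<lambda>y. G y + k) q" by (intro local_primitive_add_const) auto
      then show ?thesis
        by (rule local_primitive_cong[where W = "{b<..}"]) (use 3 in \<open>auto simp: H_def\<close>)
    qed
  qed
  then show ?thesis by blast
qed

lemma closed_segment_st:
  assumes "u \<in> J" "v \<in> J"
  shows "closed_segment (st u) (st v) \<subseteq> st ` J"
  using interval_st assms by (intro closed_segment_subset) (auto simp: is_interval_convex)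

text \<open>Bisection: near each real of the segment a combination representing f is integrated term
  by term, and adjacent pieces are glued.\<close>

lemma primitive_on_segment:
  assumes f: "fsmooth_on J f" and uv: "u \<in> J" "v \<in> J"
  shows "\<exists>F. \<forall>q\<in>closed_segment (st u) (st v). local_primitive f F q"
proof -
  define a b where "a = min (st u) (st v)" and "b = max (st u) (st v)"
  have ab: "closed_segment (st u) (st v) = {a..b}"
    by (auto simp: a_def b_def closed_segment_eq_real_ivl)
  have "a \<le> b" by (simp add: a_def b_def)
  then have "\<exists>F. \<forall>q\<in>{a..b}. local_primitive f F q"
  proof (rule Bolzano[where P = "\<lambda>a b. \<exists>F. \<forall>q\<in>{a..b}. local_primitive f F q"])
    show "\<exists>F. \<forall>q\<in>{a..c}. local_primitive f F q"
      if "\<exists>F. \<forall>q\<in>{a..b}. local_primitive f F q" "\<exists>F. \<forall>q\<in>{b..c}. local_primitive f F q"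
        "a \<le> b" "b \<le> c" for a b c
      using that local_primitive_glue by blast
    fix c assume c: "a \<le> c" "c \<le> b"
    then obtain x where x: "x \<in> J" "st x = c"
      using closed_segment_st[OF uv] unfolding ab by force
    obtain pd P V p \<alpha> where rep: "local_rep J f x pd P V p \<alpha>"
      using f x(1) unfolding fsmooth_on_def by blast
    obtain ws where ws: "deriv_chains ws V" "\<And>y. st y \<in> V \<Longrightarrow> flift pd \<alpha> p y = comb ws 0 y"
      "\<And>y. st y \<in> V \<Longrightarrow> flift pd (pderiv_at pd \<alpha>) p y = comb ws 1 y"
      using local_rep_imp_comb[OF rep] by blast
    have V: "open V" "c \<in> V" "\<And>y. y \<in> J \<Longrightarrow> st y \<in> V \<Longrightarrow> f y = comb ws 0 y"
      using rep ws(2) x(2) by (auto simp: local_rep_def)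
    obtain d where d: "d > 0" "cball c d \<subseteq> V" using V(1,2) open_contains_cball by blast
    obtain vs where vs: "deriv_chains vs (ball c d)" "\<And>k y. comb vs (Suc k) y = comb ws k y"
      using comb_antiderivative[OF ws(1) d(2)] by blast
    have "f y = comb vs 1 y" if "y \<in> J" "st y \<in> ball c d" for y
    proof -
      have "st y \<in> V" using that(2) d(2) ball_subset_cball by blast
      then show ?thesis using V(3)[OF that(1)] vs(2)[of 0 y] by simp
    qed
    then have "local_primitive f (comb vs 0) q" if "q \<in> ball c d" for q
      unfolding local_primitive_def using that vs(1)
      by (intro exI[of _ "ball c d"] exI[of _ vs]) simp
    moreover have "{p..q} \<subseteq> ball c d" if "p \<le> c" "c \<le> q" "q - p < d" for p q
      using that by (auto simp: dist_real_def)
    ultimately have "\<forall>p q. p \<le> c \<and> c \<le> q \<and> q - p < d \<longrightarrow>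
        (\<forall>s\<in>{p..q}. local_primitive f (comb vs 0) s)" by (meson subsetD)
    with d(1) show "\<exists>d>0. \<forall>p q. p \<le> c \<and> c \<le> q \<and> q - p < d \<longrightarrow>
        (\<exists>F. \<forall>q\<in>{p..q}. local_primitive f F q)" by blast
  qed
  then show ?thesis by (simp add: ab)
qed

text \<open>The standard parts of J need not form a compact set. So F v is read off from a primitive
  over the segment from \<open>st u\<close> to \<open>st v\<close> that vanishes at u; uniqueness
  makes the value independent of the primitive chosen.\<close>

lemma primitive_exists:
  assumes f: "fsmooth_on J f"
  shows "\<exists>F. \<forall>x\<in>J. local_primitive f F (st x)"
proof (cases "J = {}")
  case False
  then obtain u where u: "u \<in> J" by blast
  define prim where "prim G v \<longleftrightarrow> (\<forall>q\<in>closed_segment (st u) (st v). local_primitive f G q) \<and> G u = 0"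
    for G v
  define F where "F v = (SOME G. prim G v) v" for v
  have ex: "\<exists>G. prim G v" if v: "v \<in> J" for v
  proof -
    obtain G where "\<forall>q\<in>closed_segment (st u) (st v). local_primitive f G q"
      using primitive_on_segment[OF f u v] by blast
    then have "prim (\<lambda>y. G y + - G u) v"
      unfolding prim_def by (intro conjI ballI local_primitive_add_const) auto
    then show ?thesis by blast
  qed
  have F: "F v = G v" if v: "v \<in> J" and G: "prim G v" for G v
  proof -
    define H where "H = (SOME G. prim G v)"
    have H: "prim H v" unfolding H_def using ex[OF v] by (rule someI_ex)
    have "H u - G u = H v - G v"
      using H G by (intro primitive_unique[OF _ closed_segment_st[OF u v], of f] u v)
        (auto simp: prim_def)
    then have "H v = G v" using H G by (simp add: prim_def)
    then show ?thesis unfolding F_def H_def .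
  qed
  have "local_primitive f F (st x)" if x: "x \<in> J" for x
  proof -
    obtain G where G: "prim G x" using ex[OF x] by blast
    then have "local_primitive f G (st x)" by (simp add: prim_def)
    then obtain e where e: "e > 0" "\<forall>q\<in>ball (st x) e. local_primitive f G q"
      using local_primitive_open by blast
    have eq: "F y = G y" if y: "y \<in> J" "st y \<in> ball (st x) e" for y
    proof (rule F[OF y(1)])
      \<comment> \<open>One G is good for all y near x: the segment to \<open>st y\<close> leaves
        the segment to \<open>st x\<close> only inside the ball, where G is still a
        primitive.\<close>
      have "closed_segment (st u) (st y) \<subseteq> closed_segment (st u) (st x) \<union> ball (st x) e"
        using y(2) by (auto simp: closed_segment_eq_real_ivl dist_real_def split: if_splits)
      then show "prim G y" using G e(2) unfolding prim_def by blast
    qed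
    show ?thesis
      by (rule local_primitive_cong[OF \<open>local_primitive f G (st x)\<close> open_ball _ eq])
        (use e(1) in simp_all)
  qed
  then show ?thesis by blast
qed auto

text \<open>Subtracting F u gives an admissible primitive, and \<open>primitive_unique\<close> over
  all standard parts of J forces the value at v, as the definite description requires.\<close>

lemma fintegral_eq:
  assumes F: "\<forall>x\<in>J. local_primitive f F (st x)" and uv: "u \<in> J" "v \<in> J"
  shows "fintegral J f u v = F v - F u"
  unfolding fintegral_def fzero_eq
proof (rule the_equality)
  have "\<forall>x\<in>J. local_primitive f (\<lambda>y. F y + - F u) (st x)"
    using F local_primitive_add_const by blast
  then show "\<exists>I. fsmooth_on J I \<and> I u = 0 \<and> (\<forall>x\<in>J. fderiv_on J I x = f x) \<and> I v = F v - F u"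
    unfolding local_primitive_iff by (intro exI[of _ "\<lambda>y. F y + - F u"]) simp
  fix c assume "\<exists>I. fsmooth_on J I \<and> I u = 0 \<and> (\<forall>x\<in>J. fderiv_on J I x = f x) \<and> I v = c"
  then obtain I where I: "fsmooth_on J I \<and> (\<forall>x\<in>J. fderiv_on J I x = f x)" "I u = 0" "I v = c"
    by blast
  then have "\<forall>x\<in>J. local_primitive f I (st x)" by (simp add: local_primitive_iff)
  then have "F u - I u = F v - I v"
    using F uv is_interval_connected[OF interval_st] by (intro primitive_unique[of "st ` J" f]) auto
  then show "c = F v - F u" using I by (simp add: algebra_simps)
qed

end

lemma fint_with_imp_between: "fint_with S (Fin a) (Fin b) \<Longrightarrow> between S a b"
  by (auto simp: fint_with_def fext_lt_def between_def less_imp_le)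

theorem theorem34:
  fixes J :: "fermat set" and f :: "fermat \<Rightarrow> fermat"
    and n m :: nat
    and I K :: "nat \<Rightarrow> fermat set"
    and aI bI aK bK :: "nat \<Rightarrow> fermat"
  assumes J: "noninf_fint J"
    and f: "fsmooth_on J f"
    and I: "\<forall>i\<in>{1..n}. fint_with (I i) (Fin (aI i)) (Fin (bI i)) \<and> I i \<subseteq> J
                          \<and> aI i \<in> J \<and> bI i \<in> J"
    and K: "\<forall>j\<in>{1..m}. fint_with (K j) (Fin (aK j)) (Fin (bK j)) \<and> K j \<subseteq> J
                          \<and> aK j \<in> J \<and> bK j \<in> J"
    and Idisj: "\<forall>i\<in>{1..n}. \<forall>i'\<in>{1..n}. i \<noteq> i' \<longrightarrow> I i \<inter> I i' = {}"
    and Kdisj: "\<forall>j\<in>{1..m}. \<forall>j'\<in>{1..m}. j \<noteq> j' \<longrightarrow> K j \<inter> K j' = {}"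
    and U: "(\<Union>i\<in>{1..n}. I i) = (\<Union>j\<in>{1..m}. K j)"
  shows "fsum (\<lambda>i. fintegral J f (aI i) (bI i)) n = fsum (\<lambda>j. fintegral J f (aK j) (bK j)) m"
proof -
  obtain A where "fermat_interval J A"
    using noninf_fint_imp_fermat_interval[OF J] .
  then interpret fermat_interval J A .
  obtain F where F: "\<forall>x\<in>J. local_primitive f F (st x)"
    using primitive_exists[OF f] by blast
  have "(\<Sum>i\<in>{1..n}. fintegral J f (aI i) (bI i)) = (\<Sum>i\<in>{1..n}. F (bI i) - F (aI i))"
    using I by (intro sum.cong refl fintegral_eq[OF F]) auto
  \<comment> \<open>At this point f is gone: the identity holds for any F with values in an abelian
    group.\<close>
  also have "\<dots> = (\<Sum>j\<in>{1..m}. F (bK j) - F (aK j))"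
    using I K Idisj Kdisj
    by (intro sum_disjoint_intervals_cong[OF _ _ _ _ _ _ U] fint_with_imp_between) auto
  also have "\<dots> = (\<Sum>j\<in>{1..m}. fintegral J f (aK j) (bK j))"
    using K by (intro sum.cong refl fintegral_eq[OF F, symmetric]) auto
  finally show ?thesis by (simp add: fsum_eq)
qed

end
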